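(* Let $\{x_k\}$ be generated by Algorithm PSG_LECO (described in the context) applied to $\min_{x\in S} f(x)=\frac1N\sum_{i=1}^N f_i(x)$, $S=\{x\in\mathbb{R}^n : Ax=b\}$. Suppose that: (1) $f:\mathbb{R}^n\to\mathbb{R}$ is continuously differentiable on $\mathbb{R}^n$ and $\nabla f$ is Lipschitz continuous with constant $L>0$; (2) there is $f^*\in\mathbb{R}$ with $f(x)\ge f^*$ for all $x\in\mathbb{R}^n$; (3) the nonnegative sequence $\{\eta_k\}$ satisfies $\eta_k\le\eta<1$ for all $k\ge 0$, and the nonnegative sequence $\{\mu_k\}$ converges to zero R-linearly; (4) for some positive constant $\kappa_{\nabla}$, either $x_k\in S$ for all $k\ge 0$, or $\|\nabla f(x_k)\|\le\kappa_{\nabla}$ for all $k\ge 0$; (5) there is a constant $\nu>0$ such that $\mathbb{E}\big[\|g_k-\nabla f(x_k)\|^2\,|\,\mathcal{F}_k\big]\le\nu$ for all $k\ge 0$; (6) $\sum_{k=0}^\infty\alpha_k=\infty$ and $\sum_{k=0}^\infty\alpha_k^2<\infty$. Then, almost surely, $$\liminf_{k\to\infty}\|d(x_k)\|=0,$$ where $d(x)=\pi_S(x-\nabla f(x))-x$, and the sequence of function values $\{f(x_k)\}$ converges.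
   Context: Problem data: $f_i:\mathbb{R}^n\to\mathbb{R}$, $i=1,\dots,N$, are continuously differentiable, $A\in\mathbb{R}^{m\times n}$ with $m<n$ has full row rank, $b\in\mathbb{R}^m$, $f=\frac1N\sum_{i=1}^N f_i$, $S=\{x: Ax=b\}$. $\|\cdot\|$ is the Euclidean norm. Projections: the orthogonal projection onto $S$ is $\pi_S(y)=y-A^T(AA^T)^{-1}(Ay-b)$. An inexact projection is $\widetilde\pi_S(y)=y-A^T\widetilde\lambda(y)$ with $\widetilde\lambda(y)=(AA^T)^{-1}(Ay-b+r(y))$, where $r(y)\in\mathbb{R}^m$ is the residual in the approximate solution of $AA^T\widetilde\lambda(y)=Ay-b$. Algorithm PSG_LECO. Inputs: initial (deterministic) $x_0\in\mathbb{R}^n$, a prescribed positive sequence $\{\alpha_k\}$, prescribed nonnegative sequences $\{\eta_k\}$, $\{\mu_k\}$ with $\eta_k\in[0,\eta)$ and $\eta<1$, scalars $0<\delta_\ell<\delta_u<\infty$, and $\Delta_0\in[\alpha_0\delta_\ell,\alpha_0\delta_u]$. For $k=0,1,\dots$: (i) given a partition $\mathcal{N}_k^1,\dots,\mathcal{N}_k^r$ of $\{1,\dots,N\}$ into $r$ disjoint mini-batches (fixed or varying with $k$), select, conditionally on $\mathcal{F}_k$, an index $i\in\{1,\dots,r\}$ uniformly at random (each with probability $1/r$) and set $g_k=\frac{r}{N}\sum_{j\in\mathcal{N}_k^i}\nabla f_j(x_k)$, so that $\mathbb{E}[g_k|\mathcal{F}_k]=\nabla f(x_k)$; (ii) set $y_k=x_k-\Delta_k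 g_k$; (iii) set $x_{k+1}=\widetilde\pi_S(y_k)$, where the residual satisfies $\|r(y_k)\|\le\eta_k\|Ax_k-b\|+\mu_k$; (iv) choose a scalar $\delta_k$ and set $\Delta_{k+1}=\alpha_{k+1}\max\{\delta_\ell,\min\{\delta_k,\delta_u\}\}$. Here $\mathcal{F}_k$ is the $\sigma$-algebra generated by $x_0,\dots,x_k$ (i.e. by $g_0,\dots,g_{k-1}$), and the choices are such that $\Delta_k$ is $\mathcal{F}_k$-measurable. A nonnegative sequence $\{\mu_k\}$ converges to zero R-linearly if there are $C>0$ and $\rho\in(0,1)$ with $\mu_k\le C\rho^k$ for all $k$. *)

theory Defs
  imports "HOL-Probability.Probability"
begin

definition grad :: "('v::real_inner \<Rightarrow> real) \<Rightarrow> 'v \<Rightarrow> 'v" where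
  "grad f x = (THE D. GDERIV f x :> D)"

definition cont_diff :: "('v::real_inner \<Rightarrow> real) \<Rightarrow> bool" where
  "cont_diff f \<longleftrightarrow> (\<forall>x. f differentiable (at x)) \<and> continuous_on UNIV (grad f)"

definition avg :: "nat \<Rightarrow> (nat \<Rightarrow> 'v \<Rightarrow> real) \<Rightarrow> 'v \<Rightarrow> real" where
  "avg N fs x = (1 / real N) * (\<Sum>i=1..N. fs i x)"

definition feasible :: "real^'n^'m \<Rightarrow> real^'m \<Rightarrow> (real^'n) set" where
  "feasible A b = {x. A *v x = b}"

definition proj :: "real^'n^'m \<Rightarrow> real^'m \<Rightarrow> real^'n \<Rightarrow> real^'n" where
  "proj A b y = y - transpose A *v (matrix_inv (A ** transpose A) *v (A *v y - b))"

text \<open>The argument \<open>res\<close> is the residual \<open>r(y)\<close> left by the approximate solution of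
  the system \<open>A A\<^sup>T \<lambda> = A y - b\<close>.\<close>

definition inexact_proj :: "real^'n^'m \<Rightarrow> real^'m \<Rightarrow> real^'m \<Rightarrow> real^'n \<Rightarrow> real^'n" where
  "inexact_proj A b res y =
     y - transpose A *v (matrix_inv (A ** transpose A) *v (A *v y - b + res))"

definition search_dir ::
    "real^'n^'m \<Rightarrow> real^'m \<Rightarrow> (real^'n \<Rightarrow> real) \<Rightarrow> real^'n \<Rightarrow> real^'n" where
  "search_dir A b f x = proj A b (x - grad f x) - x"

definition R_linear_to_zero :: "(nat \<Rightarrow> real) \<Rightarrow> bool" where
  "R_linear_to_zero \<mu> \<longleftrightarrow> (\<exists>C>0. \<exists>\<rho>. 0 < \<rho> \<and> \<rho> < 1 \<and> (\<forall>k. \<mu> k \<le> C * \<rho> ^ k))"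

definition history :: "'w measure \<Rightarrow> (nat \<Rightarrow> 'w \<Rightarrow> 'v::topological_space) \<Rightarrow> nat \<Rightarrow> 'w measure" where
  "history M x k =
     sigma (space M) {x j -` B \<inter> space M | j B. j \<le> k \<and> B \<in> sets borel}"

text \<open>All quantities of a run are processes on the probability space \<open>M\<close>: \<open>batch k \<omega> 1\<close>, \dots,
  \<open>batch k \<omega> r\<close> is the partition of \<open>{1..N}\<close> used at iteration \<open>k\<close>, \<open>idx k\<close> the random index
  of the selected mini-batch, and \<open>res k\<close> the residual \<open>r(y\<^sub>k)\<close>. The partition may vary
  with \<open>k\<close> and may be chosen adaptively, but only from what is known before the index is drawn.
  The residual and the scalar \<open>\<delta> k\<close> are arbitrary, subject to the stated requirements.\<close>

locale psg_leco = prob_space M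
  for M :: "'w measure" +
  fixes N :: nat
    and fs :: "nat \<Rightarrow> real^'n \<Rightarrow> real"
    and A :: "real^'n^'m"
    and b :: "real^'m"
    and x\<^sub>0 :: "real^'n"
    and \<alpha> \<eta>s \<mu> :: "nat \<Rightarrow> real"
    and \<eta> \<delta>\<^sub>l \<delta>\<^sub>u \<Delta>\<^sub>0 :: real
    and r :: nat
    and batch :: "nat \<Rightarrow> 'w \<Rightarrow> nat \<Rightarrow> nat set"
    and idx :: "nat \<Rightarrow> 'w \<Rightarrow> nat"
    and g y x :: "nat \<Rightarrow> 'w \<Rightarrow> real^'n"
    and res :: "nat \<Rightarrow> 'w \<Rightarrow> real^'m"
    and \<delta> \<Delta> :: "nat \<Rightarrow> 'w \<Rightarrow> real"
  assumes N_pos: "1 \<le> N"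
    and fs_C1: "\<And>i. i \<in> {1..N} \<Longrightarrow> cont_diff (fs i)"
    and dims: "CARD('m) < CARD('n)"
    and full_row_rank: "rank A = CARD('m)"
    and \<alpha>_pos: "\<And>k. 0 < \<alpha> k"
    and \<eta>s_range: "\<And>k. \<eta>s k \<in> {0..<\<eta>}"
    and \<eta>_less_1: "\<eta> < 1"
    and \<mu>_nonneg: "\<And>k. 0 \<le> \<mu> k"
    and \<delta>\<^sub>l_pos: "0 < \<delta>\<^sub>l"
    and \<delta>\<^sub>l_less_\<delta>\<^sub>u: "\<delta>\<^sub>l < \<delta>\<^sub>u"
    and \<Delta>\<^sub>0_range: "\<Delta>\<^sub>0 \<in> {\<alpha> 0 * \<delta>\<^sub>l .. \<alpha> 0 * \<delta>\<^sub>u}"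
    and x_init: "\<And>\<omega>. \<omega> \<in> space M \<Longrightarrow> x 0 \<omega> = x\<^sub>0"
    and \<Delta>_init: "\<And>\<omega>. \<omega> \<in> space M \<Longrightarrow> \<Delta> 0 \<omega> = \<Delta>\<^sub>0"
    and x_measurable: "\<And>k. x k \<in> borel_measurable M"
    and \<Delta>_adapted: "\<And>k. \<Delta> k \<in> borel_measurable (history M x k)"
    and batch_partition: "\<And>k \<omega>. \<omega> \<in> space M \<Longrightarrow>
          partition_on {1..N} (batch k \<omega> ` {1..r}) \<and> inj_on (batch k \<omega>) {1..r}"
    and batch_adapted: "\<And>k i. i \<in> {1..r} \<Longrightarrow>
          (\<lambda>\<omega>. batch k \<omega> i) \<in> measurable (history M x k) (count_space (Pow {1..N}))"
    and idx_measurable: "\<And>k. idx k \<in> measurable M (count_space {1..r})"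
    and idx_uniform: "\<And>k i. i \<in> {1..r} \<Longrightarrow>
          AE \<omega> in M. real_cond_exp M (history M x k)
            (indicator {\<omega> \<in> space M. idx k \<omega> = i}) \<omega> = 1 / real r"
    and g_eq: "\<And>k \<omega>. \<omega> \<in> space M \<Longrightarrow>
          g k \<omega> = (real r / real N) *\<^sub>R (\<Sum>j\<in>batch k \<omega> (idx k \<omega>). grad (fs j) (x k \<omega>))"
    and y_eq: "\<And>k \<omega>. \<omega> \<in> space M \<Longrightarrow> y k \<omega> = x k \<omega> - \<Delta> k \<omega> *\<^sub>R g k \<omega>"
    and x_step: "\<And>k \<omega>. \<omega> \<in> space M \<Longrightarrow> x (Suc k) \<omega> = inexact_proj A b (res k \<omega>) (y k \<omega>)"
    and res_bound: "\<And>k \<omega>. \<omega> \<in> space M \<Longrightarrow>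
          norm (res k \<omega>) \<le> \<eta>s k * norm (A *v x k \<omega> - b) + \<mu> k"
    and \<Delta>_step: "\<And>k \<omega>. \<omega> \<in> space M \<Longrightarrow>
          \<Delta> (Suc k) \<omega> = \<alpha> (Suc k) * max \<delta>\<^sub>l (min (\<delta> k \<omega>) \<delta>\<^sub>u)"

end

theory Submission
  imports Defs
begin

text \<open>Let \<open>P\<close> be the orthogonal projector onto the null space of \<open>A\<close>. A step of the algorithm is
  \<open>- \<Delta>\<^sub>k P g\<^sub>k\<close> plus an orthogonal correction in the row space, whose norm is bounded by a
  deterministic summable sequence because \<open>A x\<^sub>k\<^sub>+\<^sub>1 - b\<close> equals minus the residual. Taking expectations
  in the first-order expansion of \<open>f\<close> shows that \<open>\<Delta>\<^sub>k \<parallel>P \<nabla>f(x\<^sub>k)\<parallel>\<^sup>2\<close> and \<open>\<parallel>x\<^sub>k\<^sub>+\<^sub>1 - x\<^sub>k\<parallel>\<^sup>2\<close> have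
  summable expectations, hence are almost surely summable. Together with the divergence of
  \<open>\<Sum>\<alpha>\<^sub>k\<close> this gives the limit inferior. The increments of \<open>f(x\<^sub>k)\<close> differ from almost surely
  summable terms by the martingale differences \<open>\<Delta>\<^sub>k \<langle>P \<nabla>f(x\<^sub>k), g\<^sub>k - \<nabla>f(x\<^sub>k)\<rangle>\<close>, whose variances are
  summable as well, so Kolmogorov's maximal inequality makes their series converge almost surely.\<close>

section \<open>Gradients\<close>

lemma GDERIV_inj:
  assumes "GDERIV f x :> D" "GDERIV f x :> E"
  shows "D = E"
proof -
  have "(\<lambda>h. h \<bullet> D) = (\<lambda>h. h \<bullet> E)"
    using assms unfolding gderiv_def by (rule has_derivative_unique)
  then have "(D - E) \<bullet> D = (D - E) \<bullet> E" by metis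
  then have "(D - E) \<bullet> (D - E) = 0" by (simp add: inner_diff_right)
  then show ?thesis by simp
qed

lemma grad_eqI: "GDERIV f x :> D \<Longrightarrow> grad f x = D"
  unfolding grad_def by (rule the_equality) (auto intro: GDERIV_inj)

text \<open>The derivative is a linear functional, so it is the inner product with a fixed vector:
  the image of 1 under its adjoint.\<close>

lemma GDERIV_grad:
  fixes f :: "'v::euclidean_space \<Rightarrow> real"
  assumes "f differentiable (at x)"
  shows "GDERIV f x :> grad f x"
proof -
  obtain f' where f': "(f has_derivative f') (at x)"
    using assms by (auto simp: differentiable_def)
  then have lin: "linear f'"
    by (intro bounded_linear.linear has_derivative_bounded_linear)
  have "f' = (\<lambda>h. h \<bullet> adjoint f' 1)"
    using adjoint_works[OF lin, of _ 1] by auto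
  with f' have "GDERIV f x :> adjoint f' 1"
    unfolding gderiv_def by simp
  with grad_eqI show ?thesis by metis
qed

lemma cont_diff_grad:
  fixes f :: "'v::euclidean_space \<Rightarrow> real"
  assumes "cont_diff f"
  shows "GDERIV f x :> grad f x"
  using assms by (auto simp: cont_diff_def intro: GDERIV_grad)

lemma grad_avg:
  fixes fs :: "nat \<Rightarrow> 'v::euclidean_space \<Rightarrow> real"
  assumes "\<And>i. i \<in> {1..N} \<Longrightarrow> cont_diff (fs i)"
  shows "grad (avg N fs) x = (1 / real N) *\<^sub>R (\<Sum>i=1..N. grad (fs i) x)"
proof (rule grad_eqI)
  have "((\<lambda>z. (1 / real N) * (\<Sum>i=1..N. fs i z)) has_derivative
      (\<lambda>h. (1 / real N) * (\<Sum>i=1..N. h \<bullet> grad (fs i) x))) (at x)"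
    using cont_diff_grad[OF assms, unfolded gderiv_def]
    by (intro has_derivative_mult_right has_derivative_sum) auto
  then show "GDERIV (avg N fs) x :> (1 / real N) *\<^sub>R (\<Sum>i=1..N. grad (fs i) x)"
    unfolding gderiv_def avg_def[abs_def] by (simp add: inner_sum_right)
qed

text \<open>Mean value theorem along the segment from \<open>x\<close> to \<open>z\<close>, then
  Cauchy-Schwarz and the Lipschitz bound at the intermediate point. This yields the constant
  \<open>L\<close> instead of the sharp \<open>L / 2\<close>, which suffices. The estimate is
  two-sided because convergence of the function values needs more than descent.\<close>

lemma lipschitz_grad_remainder:
  fixes f :: "'v::euclidean_space \<Rightarrow> real"
  assumes f: "cont_diff f" and L: "L-lipschitz_on UNIV (grad f)"
  shows "\<bar>f z - f x - grad f x \<bullet> (z - x)\<bar> \<le> L * (norm (z - x))\<^sup>2"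
proof -
  have "((\<lambda>t. f (x + t *\<^sub>R (z - x))) has_real_derivative
      (z - x) \<bullet> grad f (x + t *\<^sub>R (z - x))) (at t)" for t
  proof -
    have 1: "((\<lambda>t. x + t *\<^sub>R (z - x)) has_derivative (\<lambda>s. s *\<^sub>R (z - x))) (at t)"
      by (auto intro!: derivative_eq_intros)
    have "((\<lambda>t. f (x + t *\<^sub>R (z - x))) has_derivative
        (\<lambda>s. (s *\<^sub>R (z - x)) \<bullet> grad f (x + t *\<^sub>R (z - x)))) (at t)"
      using has_derivative_compose[OF 1 cont_diff_grad[OF f, unfolded gderiv_def]] by simp
    then show ?thesis
      by (simp add: has_field_derivative_def mult_commute_abs)
  qed
  then obtain t where t: "0 < t" "t < 1"
    and eq: "f z - f x = (z - x) \<bullet> grad f (x + t *\<^sub>R (z - x))"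
    using MVT2[of 0 1 "\<lambda>t. f (x + t *\<^sub>R (z - x))"
        "\<lambda>t. (z - x) \<bullet> grad f (x + t *\<^sub>R (z - x))"] by auto
  have "f z - f x - grad f x \<bullet> (z - x) = (grad f (x + t *\<^sub>R (z - x)) - grad f x) \<bullet> (z - x)"
    unfolding eq by (subst inner_diff_left) (simp only: inner_commute)
  also have "\<bar>\<dots>\<bar> \<le> norm (grad f (x + t *\<^sub>R (z - x)) - grad f x) * norm (z - x)"
    by (rule Cauchy_Schwarz_ineq2)
  also have "\<dots> \<le> (L * norm (z - x)) * norm (z - x)"
  proof (rule mult_right_mono)
    have "norm (grad f (x + t *\<^sub>R (z - x)) - grad f x) \<le> L * norm (t *\<^sub>R (z - x))"
      using lipschitz_onD[OF L, of "x + t *\<^sub>R (z - x)" x] by (simp add: dist_norm)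
    also have "\<dots> \<le> L * norm (z - x)"
      using t lipschitz_on_nonneg[OF L] by (intro mult_left_mono) (auto simp: mult_left_le_one_le)
    finally show "norm (grad f (x + t *\<^sub>R (z - x)) - grad f x) \<le> L * norm (z - x)" .
  qed simp
  finally show ?thesis by (simp add: power2_eq_square mult.assoc)
qed

section \<open>The projector onto the null space\<close>

text \<open>Under full row rank this is the Moore-Penrose pseudoinverse of \<open>A\<close>: a right
  inverse whose range is the row space.\<close>

definition pinv :: "real^'n^'m \<Rightarrow> real^'m \<Rightarrow> real^'n" where
  "pinv A w = transpose A *v (matrix_inv (A ** transpose A) *v w)"

definition nullproj :: "real^'n^'m \<Rightarrow> real^'n \<Rightarrow> real^'n" where
  "nullproj A v = v - pinv A (A *v v)"

lemma linear_pinv: "linear (pinv A)"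
  unfolding pinv_def[abs_def]
  by (simp add: matrix_vector_mul_assoc matrix_vector_mul_linear)

lemma linear_nullproj: "linear (nullproj A)"
proof -
  interpret P: linear "pinv A" by (rule linear_pinv)
  show ?thesis
    by (rule linearI)
      (simp_all add: nullproj_def P.add P.scaleR algebra_simps matrix_vector_right_distrib
        matrix_vector_mult_scaleR)
qed

lemma inner_transpose_mult: "u \<bullet> (transpose A *v w) = (A *v u) \<bullet> (w :: real^'m)"
  for A :: "real^'n^'m"
  by (metis dot_lmul_matrix inner_commute transpose_matrix_vector)

text \<open>If \<open>v\<close> is in the kernel of the Gram matrix, pairing with \<open>v\<close>
  shows that \<open>transpose A *v v\<close> has norm zero. Surjectivity of \<open>A\<close> gives
  \<open>v = A *v u\<close>, and moving \<open>A\<close> across the inner product makes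
  \<open>v \<bullet> v\<close> vanish.\<close>

lemma invertible_gram:
  fixes A :: "real^'n^'m"
  assumes "rank A = CARD('m)"
  shows "invertible (A ** transpose A)"
proof -
  have surj: "surj ((*v) A)" using assms by (simp add: full_rank_surjective)
  have "v = 0" if "(A ** transpose A) *v v = 0" for v
  proof -
    have "(transpose A *v v) \<bullet> (transpose A *v v) = 0"
      unfolding inner_transpose_mult using that by (simp add: matrix_vector_mul_assoc del: transpose_matrix_vector)
    then have z: "transpose A *v v = 0" by simp
    obtain u where "v = A *v u" using surj by auto
    then have "v \<bullet> v = u \<bullet> (transpose A *v v)" by (simp only: inner_transpose_mult)
    then show ?thesis using z by simp
  qed
  then show ?thesis
    using matrix_left_invertible_ker invertible_left_inverse by blast
qed

lemma mult_matrix_inv: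
  assumes "invertible B"
  shows "B ** matrix_inv B = mat 1"
  using assms unfolding invertible_def matrix_inv_def by (rule someI2_ex) simp

context
  fixes A :: "real^'n^'m"
  assumes full_rank: "rank A = CARD('m)"
begin

lemma mult_pinv: "A *v pinv A w = w"
  using mult_matrix_inv[OF invertible_gram[OF full_rank]]
  by (simp add: pinv_def matrix_vector_mul_assoc matrix_mul_assoc del: transpose_matrix_vector)

lemma mult_nullproj: "A *v nullproj A v = 0"
  by (simp add: nullproj_def matrix_vector_mult_diff_distrib mult_pinv)

lemma nullproj_orthogonal_pinv: "nullproj A v \<bullet> pinv A w = 0"
  unfolding pinv_def inner_transpose_mult by (simp add: mult_nullproj)

lemma nullproj_pinv: "nullproj A (pinv A w) = 0"
  by (simp add: nullproj_def mult_pinv)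

lemma nullproj_nullproj: "nullproj A (nullproj A v) = nullproj A v"
  using linear_0[OF linear_pinv] by (simp add: nullproj_def[of A "nullproj A v"] mult_nullproj)

text \<open>Self-adjointness and idempotence in one formula: the row-space component of
  \<open>u\<close> is orthogonal to every projected vector, so only its null-space component
  contributes.\<close>

lemma inner_nullproj: "u \<bullet> nullproj A v = nullproj A u \<bullet> nullproj A v"
proof -
  have "u \<bullet> nullproj A v = (nullproj A u + pinv A (A *v u)) \<bullet> nullproj A v"
    by (simp add: nullproj_def[of A u])
  also have "\<dots> = nullproj A u \<bullet> nullproj A v"
    by (simp add: inner_add_left inner_commute[of "pinv A (A *v u)"] nullproj_orthogonal_pinv)
  finally show ?thesis .
qed

lemma inner_nullproj_left: "nullproj A u \<bullet> v = nullproj A u \<bullet> nullproj A v"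
  using inner_nullproj[of v u] by (simp add: inner_commute)

lemma norm_nullproj_add_pinv:
  "(norm (nullproj A v + pinv A w))\<^sup>2 = (norm (nullproj A v))\<^sup>2 + (norm (pinv A w))\<^sup>2"
  by (rule norm_add_Pythagorean) (simp add: orthogonal_def nullproj_orthogonal_pinv)

lemma norm_nullproj_le: "norm (nullproj A v) \<le> norm v"
proof -
  have "(norm v)\<^sup>2 = (norm (nullproj A v))\<^sup>2 + (norm (pinv A (A *v v)))\<^sup>2"
    using norm_nullproj_add_pinv[of v "A *v v"] by (simp add: nullproj_def)
  then have "(norm (nullproj A v))\<^sup>2 \<le> (norm v)\<^sup>2" by simp
  then show ?thesis by (rule power2_le_imp_le) simp
qed

end

section \<open>Convergence of series of random variables\<close>

lemma bounded_image_norm: "bounded (X ` S) \<Longrightarrow> bounded ((\<lambda>s. norm (X s)) ` S)"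
  by (auto simp: bounded_iff)

lemma bounded_image_inner:
  fixes X Y :: "'s \<Rightarrow> 'v::real_inner"
  assumes "bounded (X ` S)" "bounded (Y ` S)"
  shows "bounded ((\<lambda>s. X s \<bullet> Y s) ` S)"
proof -
  obtain B C where B: "\<And>s. s \<in> S \<Longrightarrow> norm (X s) \<le> B" and C: "\<And>s. s \<in> S \<Longrightarrow> norm (Y s) \<le> C"
    using assms unfolding bounded_iff by auto
  have "norm (X s \<bullet> Y s) \<le> B * C" if "s \<in> S" for s
    using Cauchy_Schwarz_ineq2[of "X s" "Y s"] mult_mono'[OF B C, OF that that] by simp
  then show ?thesis unfolding bounded_iff by auto
qed

lemma bounded_image_mult:
  fixes X Y :: "'s \<Rightarrow> real"
  shows "bounded (X ` S) \<Longrightarrow> bounded (Y ` S) \<Longrightarrow> bounded ((\<lambda>s. X s * Y s) ` S)"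
  using bounded_image_inner[of X S Y] by simp

lemma bounded_image_scaleR:
  fixes X :: "'s \<Rightarrow> real" and Y :: "'s \<Rightarrow> 'v::real_normed_vector"
  assumes "bounded (X ` S)" "bounded (Y ` S)"
  shows "bounded ((\<lambda>s. X s *\<^sub>R Y s) ` S)"
  using bounded_image_mult[OF assms(1) bounded_image_norm[OF assms(2)]]
  by (auto simp: bounded_iff abs_mult)

lemma bounded_image_power:
  fixes X :: "'s \<Rightarrow> real"
  shows "bounded (X ` S) \<Longrightarrow> bounded ((\<lambda>s. X s ^ n) ` S)"
proof (induction n)
  case (Suc n)
  then show ?case unfolding power_Suc by (intro bounded_image_mult) auto
qed (auto simp: bounded_iff)

lemma bounded_image_sum:
  fixes X :: "'i \<Rightarrow> 's \<Rightarrow> 'v::real_normed_vector"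
  assumes "\<And>i. i \<in> I \<Longrightarrow> bounded (X i ` S)"
  shows "bounded ((\<lambda>s. \<Sum>i\<in>I. X i s) ` S)"
  using assms
proof (induction I rule: infinite_finite_induct)
  case (insert i I)
  then show ?case using bounded_plus_comp[of "X i" S "\<lambda>s. \<Sum>i\<in>I. X i s"] by simp
qed (auto simp: bounded_iff)

lemma bounded_image_continuous:
  fixes X :: "'s \<Rightarrow> 'v::heine_borel" and h :: "'v \<Rightarrow> 'u::metric_space"
  assumes "bounded (X ` S)" "continuous_on UNIV h"
  shows "bounded ((\<lambda>s. h (X s)) ` S)"
proof -
  have "compact (h ` closure (X ` S))"
    using assms by (intro compact_continuous_image) (auto intro: continuous_on_subset)
  then have "bounded (h ` closure (X ` S))" by (rule compact_imp_bounded)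
  then show ?thesis
    by (rule bounded_subset) (use closure_subset in fastforce)
qed

lemma (in finite_measure) integrable_bounded_image:
  fixes X :: "'a \<Rightarrow> 'v::{banach, second_countable_topology}"
  assumes "bounded (X ` space M)" "X \<in> borel_measurable M"
  shows "integrable M X"
proof -
  obtain B where "\<And>s. s \<in> space M \<Longrightarrow> norm (X s) \<le> B"
    using assms(1) unfolding bounded_iff by auto
  then show ?thesis by (intro integrable_const_bound[of X B] AE_I2 assms(2)) auto
qed

text \<open>For nonnegative terms sum and expectation commute, so the random sum has finite
  expectation and is therefore finite almost surely.\<close>

lemma (in prob_space) AE_summable_of_summable_expectation:
  fixes Z :: "nat \<Rightarrow> 'a \<Rightarrow> real"
  assumes int: "\<And>k. integrable M (Z k)"
    and nonneg: "\<And>k \<omega>. \<omega> \<in> space M \<Longrightarrow> 0 \<le> Z k \<omega>"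
    and sum: "summable (\<lambda>k. expectation (Z k))"
  shows "AE \<omega> in M. summable (\<lambda>k. Z k \<omega>)"
proof -
  have [measurable]: "Z k \<in> borel_measurable M" for k using int by auto
  have "(\<integral>\<^sup>+ \<omega>. (\<Sum>k. ennreal (Z k \<omega>)) \<partial>M) = (\<Sum>k. \<integral>\<^sup>+ \<omega>. ennreal (Z k \<omega>) \<partial>M)"
    by (rule nn_integral_suminf) simp
  also have "\<dots> = (\<Sum>k. ennreal (expectation (Z k)))"
    by (intro suminf_cong nn_integral_eq_integral int AE_I2 nonneg)
  also have "\<dots> \<noteq> \<infinity>"
    using ennreal_suminf_neq_top[OF sum integral_nonneg_AE[OF AE_I2[OF nonneg]]] by simp
  finally have "AE \<omega> in M. (\<Sum>k. ennreal (Z k \<omega>)) \<noteq> \<infinity>"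
    by (intro nn_integral_PInf_AE) auto
  then show ?thesis
  proof (rule AE_mp, intro AE_I2 impI)
    fix \<omega> assume \<omega>: "\<omega> \<in> space M" and "(\<Sum>k. ennreal (Z k \<omega>)) \<noteq> \<infinity>"
    then show "summable (\<lambda>k. Z k \<omega>)" using nonneg[OF \<omega>] by (intro summable_suminf_not_top) auto
  qed
qed

text \<open>The martingale property is encoded by orthogonality to bounded
  \<open>F k\<close>-measurable test functions instead of conditional expectations. This is the form
  in which it is used below, and the form that unbiasedness of the stochastic gradient
  supplies.\<close>

locale bounded_martingale_differences = prob_space M
  for M :: "'w measure" +
  fixes F :: "nat \<Rightarrow> 'w measure" and m :: "nat \<Rightarrow> 'w \<Rightarrow> real"
  assumes subalg: "\<And>k. subalgebra M (F k)"
    and filtration: "\<And>j k. j \<le> k \<Longrightarrow> sets (F j) \<subseteq> sets (F k)"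
    and adapted: "\<And>k. m k \<in> borel_measurable (F (Suc k))"
    and bounded_m: "\<And>k. bounded (m k ` space M)"
    and orthogonal: "\<And>k H. H \<in> borel_measurable (F k) \<Longrightarrow> bounded (H ` space M) \<Longrightarrow>
          expectation (\<lambda>\<omega>. H \<omega> * m k \<omega>) = 0"
begin

lemma space_F: "space (F k) = space M"
  using subalg by (simp add: subalgebra_def)

lemma measurable_F_M: "X \<in> borel_measurable (F k) \<Longrightarrow> X \<in> borel_measurable M"
  by (rule measurable_from_subalg[OF subalg])

lemma measurable_F_mono: "X \<in> borel_measurable (F j) \<Longrightarrow> j \<le> k \<Longrightarrow> X \<in> borel_measurable (F k)"
  by (rule measurable_from_subalg[of "F k" "F j"]) (auto simp: subalgebra_def space_F filtration)

lemma measurable_m: "j < k \<Longrightarrow> m j \<in> borel_measurable (F k)"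
  by (rule measurable_F_mono[OF adapted]) simp

text \<open>Pythagoras for martingale transforms: in the square of the next partial sum, the earlier
  sum times \<open>H n\<close> is a bounded \<open>F n\<close>-measurable test function for
  \<open>m n\<close>, so the cross term has expectation zero.\<close>

lemma expectation_transform_square:
  assumes H: "\<And>k. H k \<in> borel_measurable (F k)" and H1: "\<And>k \<omega>. \<bar>H k \<omega>\<bar> \<le> 1"
  shows "expectation (\<lambda>\<omega>. (\<Sum>k<n. H k \<omega> * m k \<omega>)\<^sup>2) = (\<Sum>k<n. expectation (\<lambda>\<omega>. (H k \<omega> * m k \<omega>)\<^sup>2))"
proof (induction n)
  case (Suc n)
  let ?S = "\<lambda>\<omega>. \<Sum>k<n. H k \<omega> * m k \<omega>"
  have HF: "H j \<in> borel_measurable (F k)" if "j \<le> k" for j k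
    using H that by (rule measurable_F_mono)
  have bH: "bounded (H k ` space M)" for k using H1 by (auto simp: bounded_iff)
  have bS: "bounded (?S ` space M)"
    by (intro bounded_image_sum bounded_image_mult bH bounded_m)
  have mS: "?S \<in> borel_measurable (F n)"
    by (intro borel_measurable_sum borel_measurable_times HF measurable_m) auto
  have MH: "H n \<in> borel_measurable M" by (rule measurable_F_M[OF H])
  have Mm: "m n \<in> borel_measurable M" by (rule measurable_F_M[OF adapted])
  have MS: "?S \<in> borel_measurable M" by (rule measurable_F_M[OF mS])
  have cross: "expectation (\<lambda>\<omega>. (2 * ?S \<omega> * H n \<omega>) * m n \<omega>) = 0"
    using mS H by (intro orthogonal bounded_image_mult bS bH borel_measurable_times) (auto simp: bounded_iff)
  have i1: "integrable M (\<lambda>\<omega>. (?S \<omega>)\<^sup>2)"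
    using MS by (intro integrable_bounded_image bounded_image_power bS) auto
  have i2: "integrable M (\<lambda>\<omega>. (2 * ?S \<omega> * H n \<omega>) * m n \<omega>)"
    using MS MH Mm
    by (intro integrable_bounded_image bounded_image_mult bS bH bounded_m borel_measurable_times)
      (auto simp: bounded_iff)
  have i3: "integrable M (\<lambda>\<omega>. (H n \<omega> * m n \<omega>)\<^sup>2)"
    using MH Mm
    by (intro integrable_bounded_image bounded_image_power bounded_image_mult bH bounded_m) auto
  have "(\<lambda>\<omega>. (\<Sum>k<Suc n. H k \<omega> * m k \<omega>)\<^sup>2) =
      (\<lambda>\<omega>. (?S \<omega>)\<^sup>2 + (2 * ?S \<omega> * H n \<omega>) * m n \<omega> + (H n \<omega> * m n \<omega>)\<^sup>2)"
    by (simp add: fun_eq_iff power2_sum algebra_simps)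
  then have "expectation (\<lambda>\<omega>. (\<Sum>k<Suc n. H k \<omega> * m k \<omega>)\<^sup>2) =
      expectation (\<lambda>\<omega>. (?S \<omega>)\<^sup>2) + expectation (\<lambda>\<omega>. (H n \<omega> * m n \<omega>)\<^sup>2)"
    using i1 i2 i3 cross by simp
  then show ?case using Suc by simp
qed simp

text \<open>Kolmogorov's maximal inequality: stopping the partial sums as soon as they leave
  \<open>(-\<epsilon>, \<epsilon>)\<close> is a transform by predictable indicators, so the stopped sum has no larger variance,
  and Chebyshev's inequality applies to it at the final time.\<close>

lemma maximal_inequality:
  assumes \<epsilon>: "0 < \<epsilon>"
  shows "prob {\<omega> \<in> space M. \<exists>j\<in>{n..l}. \<epsilon> \<le> \<bar>\<Sum>i=n..<j. m i \<omega>\<bar>}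
    \<le> (\<Sum>k=n..<l. expectation (\<lambda>\<omega>. (m k \<omega>)\<^sup>2)) / \<epsilon>\<^sup>2"
proof -
  let ?S = "\<lambda>j \<omega>. \<Sum>i=n..<j. m i \<omega>"
  \<comment> \<open>The value 1 means that no exit has occurred up to time \<open>k\<close>. The sum
    \<open>?S k\<close> only involves \<open>m i\<close> with \<open>i < k\<close>, which makes
    \<open>H k\<close> measurable with respect to \<open>F k\<close>.\<close>
  define H where "H k \<omega> = (if n \<le> k \<and> (\<forall>j\<in>{n..k}. \<bar>?S j \<omega>\<bar> < \<epsilon>) then 1 else 0 :: real)" for k \<omega>
  let ?T = "\<lambda>\<omega>. \<Sum>k<l. H k \<omega> * m k \<omega>"
  have mS: "?S j \<in> borel_measurable (F k)" if "j \<le> k" for j k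
    using that by (intro borel_measurable_sum measurable_m) auto
  have H: "H k \<in> borel_measurable (F k)" for k
  proof -
    have "Measurable.pred (F k) (\<lambda>\<omega>. \<forall>j\<in>{n..k}. \<bar>?S j \<omega>\<bar> < \<epsilon>)"
    proof (rule pred_intros_finite)
      fix j assume "j \<in> {n..k}"
      then have [measurable]: "?S j \<in> borel_measurable (F k)" by (intro mS) auto
      show "Measurable.pred (F k) (\<lambda>\<omega>. \<bar>?S j \<omega>\<bar> < \<epsilon>)" by measurable
    qed simp
    then show ?thesis unfolding H_def[abs_def] by measurable
  qed
  have H1: "\<bar>H k \<omega>\<bar> \<le> 1" for k \<omega> by (simp add: H_def)
  have Mm: "m k \<in> borel_measurable M" for k by (rule measurable_F_M[OF adapted])
  have MH: "H k \<in> borel_measurable M" for k by (rule measurable_F_M[OF H])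
  have MT: "?T \<in> borel_measurable M" using MH Mm by auto
  have bH: "bounded (H k ` space M)" for k using H1 by (auto simp: bounded_iff)
  have iT: "integrable M (\<lambda>\<omega>. (?T \<omega>)\<^sup>2)"
    using MT
    by (intro integrable_bounded_image bounded_image_power bounded_image_sum bounded_image_mult
        bH bounded_m) auto
  have stopped: "\<epsilon>\<^sup>2 \<le> (?T \<omega>)\<^sup>2" if ex: "\<exists>j\<in>{n..l}. \<epsilon> \<le> \<bar>?S j \<omega>\<bar>" for \<omega>
  proof -
    define j where "j = (LEAST j. n \<le> j \<and> \<epsilon> \<le> \<bar>?S j \<omega>\<bar>)"
    obtain j0 where j0: "n \<le> j0" "j0 \<le> l" "\<epsilon> \<le> \<bar>?S j0 \<omega>\<bar>" using ex by auto
    have j: "n \<le> j" "\<epsilon> \<le> \<bar>?S j \<omega>\<bar>"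
      using LeastI[of "\<lambda>j. n \<le> j \<and> \<epsilon> \<le> \<bar>?S j \<omega>\<bar>" j0] j0 by (auto simp: j_def)
    have "j \<le> j0" unfolding j_def using j0 by (intro Least_le) auto
    with j0 have jl: "j \<le> l" by simp
    have before: "\<bar>?S i \<omega>\<bar> < \<epsilon>" if "n \<le> i" "i < j" for i
      using not_less_Least[of i "\<lambda>j. n \<le> j \<and> \<epsilon> \<le> \<bar>?S j \<omega>\<bar>"] that by (auto simp: j_def)
    \<comment> \<open>From the first exit time \<open>j\<close> on all indicators vanish, so the
      stopped sum at time \<open>l\<close> is frozen at \<open>?S j\<close>, whose modulus is at
      least \<epsilon>.\<close>
    have Hv: "H k \<omega> = (if n \<le> k \<and> k < j then 1 else 0)" for k
      using before j by (force simp: H_def)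
    have "?T \<omega> = (\<Sum>k<l. if k \<in> {n..<j} then m k \<omega> else 0)"
      by (intro sum.cong) (auto simp: Hv)
    also have "\<dots> = (\<Sum>k\<in>{..<l} \<inter> {n..<j}. m k \<omega>)" by (subst sum.inter_restrict) auto
    also have "{..<l} \<inter> {n..<j} = {n..<j}" using jl by auto
    finally have "\<epsilon> \<le> \<bar>?T \<omega>\<bar>" using j by simp
    then show ?thesis using \<epsilon> by (metis abs_le_square_iff abs_of_pos)
  qed
  have "prob {\<omega> \<in> space M. \<exists>j\<in>{n..l}. \<epsilon> \<le> \<bar>?S j \<omega>\<bar>} \<le> prob {\<omega> \<in> space M. \<epsilon>\<^sup>2 \<le> (?T \<omega>)\<^sup>2}"
    using stopped MT by (intro finite_measure_mono) auto
  also have "\<dots> \<le> expectation (\<lambda>\<omega>. (?T \<omega>)\<^sup>2) / \<epsilon>\<^sup>2"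
    by (rule integral_Markov_inequality_measure[where A="{}"]) (use iT \<epsilon> in auto)
  also have "\<dots> \<le> (\<Sum>k=n..<l. expectation (\<lambda>\<omega>. (m k \<omega>)\<^sup>2)) / \<epsilon>\<^sup>2"
  proof (rule divide_right_mono)
    have "expectation (\<lambda>\<omega>. (?T \<omega>)\<^sup>2) = (\<Sum>k<l. expectation (\<lambda>\<omega>. (H k \<omega> * m k \<omega>)\<^sup>2))"
      by (rule expectation_transform_square[OF H H1])
    also have "\<dots> \<le> (\<Sum>k<l. if k \<in> {n..<l} then expectation (\<lambda>\<omega>. (m k \<omega>)\<^sup>2) else 0)"
    proof (rule sum_mono)
      fix k assume k: "k \<in> {..<l}"
      show "expectation (\<lambda>\<omega>. (H k \<omega> * m k \<omega>)\<^sup>2)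
          \<le> (if k \<in> {n..<l} then expectation (\<lambda>\<omega>. (m k \<omega>)\<^sup>2) else 0)"
      proof (cases "n \<le> k")
        case True
        have "expectation (\<lambda>\<omega>. (H k \<omega> * m k \<omega>)\<^sup>2) \<le> expectation (\<lambda>\<omega>. (m k \<omega>)\<^sup>2)"
        proof (rule integral_mono)
          show "integrable M (\<lambda>\<omega>. (H k \<omega> * m k \<omega>)\<^sup>2)"
            using MH Mm
            by (intro integrable_bounded_image bounded_image_power bounded_image_mult bH bounded_m) auto
          show "integrable M (\<lambda>\<omega>. (m k \<omega>)\<^sup>2)"
            using Mm by (intro integrable_bounded_image bounded_image_power bounded_m) auto
          show "(H k \<omega> * m k \<omega>)\<^sup>2 \<le> (m k \<omega>)\<^sup>2" for \<omega> by (simp add: H_def)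
        qed
        then show ?thesis using True k by simp
      next
        case False
        then show ?thesis by (simp add: H_def)
      qed
    qed
    also have "\<dots> = (\<Sum>k\<in>{..<l} \<inter> {n..<l}. expectation (\<lambda>\<omega>. (m k \<omega>)\<^sup>2))"
      by (subst sum.inter_restrict) auto
    also have "{..<l} \<inter> {n..<l} = {n..<l}" by auto
    finally show "expectation (\<lambda>\<omega>. (?T \<omega>)\<^sup>2) \<le> (\<Sum>k=n..<l. expectation (\<lambda>\<omega>. (m k \<omega>)\<^sup>2))" .
  qed simp
  finally show ?thesis .
qed

text \<open>By the maximal inequality the probability that the partial sums started at
  \<open>n\<close> ever reach size \<epsilon> is at most a tail of the variance series over
  \<open>\<epsilon>\<^sup>2\<close>. The tails tend to zero, so almost surely some starting point
  keeps the partial sums below \<epsilon>, which gives the Cauchy criterion.\<close>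

theorem AE_summable:
  assumes sum: "summable (\<lambda>k. expectation (\<lambda>\<omega>. (m k \<omega>)\<^sup>2))"
  shows "AE \<omega> in M. summable (\<lambda>k. m k \<omega>)"
proof -
  let ?S = "\<lambda>n j \<omega>. \<Sum>i=n..<j. m i \<omega>"
  let ?v = "\<lambda>k. expectation (\<lambda>\<omega>. (m k \<omega>)\<^sup>2)"
  have [measurable]: "m k \<in> borel_measurable M" for k by (rule measurable_F_M[OF adapted])
  have tail: "AE \<omega> in M. \<exists>n. \<forall>j\<ge>n. \<bar>?S n j \<omega>\<bar> < \<epsilon>" if \<epsilon>: "0 < \<epsilon>" for \<epsilon>
  proof -
    define B where "B n l = {\<omega> \<in> space M. \<exists>j\<in>{n..l}. \<epsilon> \<le> \<bar>?S n j \<omega>\<bar>}" for n l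
    have Bm: "B n l \<in> events" for n l unfolding B_def by measurable
    \<comment> \<open>The maximal inequality has a finite horizon \<open>l\<close>; the events
      increase with \<open>l\<close>, so continuity from below passes to the infinite
      horizon.\<close>
    have UB: "prob (\<Union>l. B n l) \<le> (\<Sum>k. ?v (k + n)) / \<epsilon>\<^sup>2" for n
    proof (rule LIMSEQ_le_const2)
      show "(\<lambda>l. prob (B n l)) \<longlonglongrightarrow> prob (\<Union>l. B n l)"
        using Bm by (intro finite_Lim_measure_incseq) (auto simp: incseq_def B_def)
      have "prob (B n l) \<le> (\<Sum>k. ?v (k + n)) / \<epsilon>\<^sup>2" if "n \<le> l" for l
      proof -
        have "prob (B n l) \<le> (\<Sum>k=n..<l. ?v k) / \<epsilon>\<^sup>2"
          unfolding B_def by (rule maximal_inequality[OF \<epsilon>])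
        also have "(\<Sum>k=n..<l. ?v k) = (\<Sum>k<l-n. ?v (k + n))"
          using sum.shift_bounds_nat_ivl[of ?v 0 n "l - n"] that by (simp add: lessThan_atLeast0)
        also have "\<dots> \<le> (\<Sum>k. ?v (k + n))"
          using sum by (intro sum_le_suminf) (auto intro: summable_ignore_initial_segment)
        finally show ?thesis using \<epsilon> by (simp add: divide_right_mono)
      qed
      then show "\<exists>N. \<forall>l\<ge>N. prob (B n l) \<le> (\<Sum>k. ?v (k + n)) / \<epsilon>\<^sup>2" by auto
    qed
    have lim: "(\<lambda>n. (\<Sum>k. ?v (k + n)) / \<epsilon>\<^sup>2) \<longlonglongrightarrow> 0 / \<epsilon>\<^sup>2"
      using \<epsilon> by (intro tendsto_divide suminf_exist_split2 sum) auto
    have "prob (\<Inter>n. \<Union>l. B n l) \<le> 0"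
    proof (rule LIMSEQ_le_const)
      show "(\<lambda>n. (\<Sum>k. ?v (k + n)) / \<epsilon>\<^sup>2) \<longlonglongrightarrow> 0" using lim by simp
      have "prob (\<Inter>n. \<Union>l. B n l) \<le> prob (\<Union>l. B n l)" for n
        using Bm by (intro finite_measure_mono) auto
      then show "\<exists>N. \<forall>n\<ge>N. prob (\<Inter>n. \<Union>l. B n l) \<le> (\<Sum>k. ?v (k + n)) / \<epsilon>\<^sup>2"
        using UB order_trans by blast
    qed
    then have "prob (\<Inter>n. \<Union>l. B n l) = 0" by (simp add: measure_le_0_iff)
    then have "AE \<omega> in M. \<omega> \<notin> (\<Inter>n. \<Union>l. B n l)"
      using Bm by (subst (asm) prob_eq_0) auto
    then show ?thesis
    proof (rule AE_mp, intro AE_I2 impI)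
      fix \<omega> assume "\<omega> \<in> space M" "\<omega> \<notin> (\<Inter>n. \<Union>l. B n l)"
      then obtain n where "\<And>l. \<omega> \<notin> B n l" "\<omega> \<in> space M" by auto
      then have "\<forall>j\<ge>n. \<bar>?S n j \<omega>\<bar> < \<epsilon>" unfolding B_def by force
      then show "\<exists>n. \<forall>j\<ge>n. \<bar>?S n j \<omega>\<bar> < \<epsilon>" ..
    qed
  qed
  \<comment> \<open>Only countably many tolerances are used, so that a single null set serves all of
    them.\<close>
  have "AE \<omega> in M. \<forall>p. \<exists>n. \<forall>j\<ge>n. \<bar>?S n j \<omega>\<bar> < 1 / real (Suc p)"
    unfolding AE_all_countable by (intro allI tail) simp
  then show ?thesis
  proof (rule AE_mp, intro AE_I2 impI)
    fix \<omega> assume *: "\<forall>p. \<exists>n. \<forall>j\<ge>n. \<bar>?S n j \<omega>\<bar> < 1 / real (Suc p)"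
    show "summable (\<lambda>k. m k \<omega>)" unfolding summable_Cauchy
    proof (intro allI impI)
      fix e :: real assume e: "0 < e"
      obtain p where p: "1 / real (Suc p) < e / 2" using e nat_approx_posE[of "e / 2"] by auto
      \<comment> \<open>Half of \<open>e\<close> is used because a block \<open>?S i j\<close> is
        the difference of two sums that start at \<open>n\<close>.\<close>
      obtain n where n: "\<And>j. n \<le> j \<Longrightarrow> \<bar>?S n j \<omega>\<bar> < e / 2" using * p by (meson less_trans)
      have "norm (?S i j \<omega>) < e" if i: "n \<le> i" for i j
      proof (cases "i \<le> j")
        case True
        have "?S n i \<omega> + ?S i j \<omega> = ?S n j \<omega>" by (rule sum.atLeastLessThan_concat[OF i True])
        then show ?thesis using n[OF i] n[of j] True i by (simp add: abs_if split: if_splits)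
      next
        case False
        then show ?thesis using e by simp
      qed
      then show "\<exists>N. \<forall>m'\<ge>N. \<forall>n. norm (?S m' n \<omega>) < e" by blast
    qed
  qed
qed

end

section \<open>One step of the algorithm\<close>

lemma subalgebra_history:
  assumes "\<And>k. X k \<in> borel_measurable M"
  shows "subalgebra M (history M X k)"
proof -
  have "{X j -` B \<inter> space M | j B. j \<le> k \<and> B \<in> sets borel} \<subseteq> sets M"
    using assms by (auto intro: measurable_sets)
  then have "sigma_sets (space M) {X j -` B \<inter> space M | j B. j \<le> k \<and> B \<in> sets borel} \<subseteq> sets M"
    by (rule sets.sigma_sets_subset)
  then show ?thesis
    unfolding subalgebra_def history_def
    by (subst sets_measure_of) (auto simp: space_measure_of_conv)
qed

lemma sets_history_mono: "j \<le> k \<Longrightarrow> sets (history M X j) \<subseteq> sets (history M X k)"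
proof -
  assume "j \<le> k"
  then have "sigma_sets (space M) {X i -` B \<inter> space M | i B. i \<le> j \<and> B \<in> sets borel}
    \<subseteq> sigma_sets (space M) {X i -` B \<inter> space M | i B. i \<le> k \<and> B \<in> sets borel}"
    by (intro sigma_sets_mono') (blast intro: order_trans)
  moreover have "{X i -` B \<inter> space M | i B. i \<le> l \<and> B \<in> sets borel} \<subseteq> Pow (space M)" for l
    by auto
  ultimately show ?thesis unfolding history_def by (simp add: sets_measure_of)
qed

lemma measurable_history: "j \<le> k \<Longrightarrow> X j \<in> borel_measurable (history M X k)"
  unfolding history_def
  by (rule measurableI) (auto simp: sets_measure_of space_measure_of_conv intro!: sigma_sets.Basic)

context psg_leco
begin

abbreviation F :: "nat \<Rightarrow> 'w measure" where "F \<equiv> history M x"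

abbreviation f :: "real^'n \<Rightarrow> real" where "f \<equiv> avg N fs"

abbreviation P :: "real^'n \<Rightarrow> real^'n" where "P \<equiv> nullproj A"

text \<open>The candidate gradients, one for each batch index. They are determined by the history,
  so the only fresh randomness in \<open>g k\<close> is the choice of the index.\<close>

definition G :: "nat \<Rightarrow> nat \<Rightarrow> 'w \<Rightarrow> real^'n" where
  "G k i \<omega> = (real r / real N) *\<^sub>R (\<Sum>j\<in>batch k \<omega> i. grad (fs j) (x k \<omega>))"

definition pgrad :: "nat \<Rightarrow> 'w \<Rightarrow> real^'n" where
  "pgrad k \<omega> = P (grad f (x k \<omega>))"

text \<open>Deterministic majorant of the infeasibility of the iterates: the residual requirement
  read as a recursion, with \<open>\<eta>s k\<close> replaced by the uniform bound \<eta>.\<close>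

fun infeas :: "nat \<Rightarrow> real" where
  "infeas 0 = norm (A *v x\<^sub>0 - b)"
| "infeas (Suc k) = \<eta> * infeas k + \<mu> k"

lemma subalg: "subalgebra M (F k)"
  by (rule subalgebra_history[OF x_measurable])

lemma space_F: "space (F k) = space M"
  using subalg by (simp add: subalgebra_def)

lemma measurable_F_M: "X \<in> borel_measurable (F k) \<Longrightarrow> X \<in> borel_measurable M"
  by (rule measurable_from_subalg[OF subalg])

lemma x_measurable_F: "j \<le> k \<Longrightarrow> x j \<in> borel_measurable (F k)"
  by (rule measurable_history)

lemma r_pos: "0 < r"
proof (rule ccontr)
  assume "\<not> 0 < r"
  obtain \<omega> where "\<omega> \<in> space M" using not_empty by auto
  from batch_partition[OF this, of 0] \<open>\<not> 0 < r\<close> N_pos show False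
    by (auto simp: partition_on_def)
qed

lemma \<eta>_pos: "0 < \<eta>"
  using \<eta>s_range[of 0] by auto

lemma \<Delta>_bounds:
  assumes "\<omega> \<in> space M"
  shows "\<alpha> k * \<delta>\<^sub>l \<le> \<Delta> k \<omega>" "\<Delta> k \<omega> \<le> \<alpha> k * \<delta>\<^sub>u"
proof -
  have "\<alpha> k * \<delta>\<^sub>l \<le> \<Delta> k \<omega> \<and> \<Delta> k \<omega> \<le> \<alpha> k * \<delta>\<^sub>u"
  proof (cases k)
    case 0
    then show ?thesis using \<Delta>_init[OF assms] \<Delta>\<^sub>0_range by simp
  next
    case (Suc j)
    then show ?thesis
      using \<Delta>_step[OF assms, of j] \<alpha>_pos[of "Suc j"] \<delta>\<^sub>l_less_\<delta>\<^sub>u by auto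
  qed
  then show "\<alpha> k * \<delta>\<^sub>l \<le> \<Delta> k \<omega>" "\<Delta> k \<omega> \<le> \<alpha> k * \<delta>\<^sub>u" by auto
qed

lemma \<Delta>_pos: "\<omega> \<in> space M \<Longrightarrow> 0 < \<Delta> k \<omega>"
  using \<Delta>_bounds(1)[of \<omega> k] mult_pos_pos[OF \<alpha>_pos[of k] \<delta>\<^sub>l_pos] by linarith

lemma linear_P: "linear P" by (rule linear_nullproj)

lemma P_measurable [measurable]: "P \<in> borel_measurable borel"
  by (intro borel_measurable_continuous_onI linear_continuous_on linear_conv_bounded_linear[THEN iffD1] linear_P)

text \<open>By linearity of \<open>pinv A\<close>, the part of the projection that acts on the
  gradient step turns \<open>g k\<close> into \<open>P (g k)\<close>. What remains depends on the
  old infeasibility and the residual only.\<close>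

lemma x_Suc_eq:
  assumes \<omega>: "\<omega> \<in> space M"
  shows "x (Suc k) \<omega> = x k \<omega> - \<Delta> k \<omega> *\<^sub>R P (g k \<omega>) - pinv A (A *v x k \<omega> - b + res k \<omega>)"
proof -
  interpret pi: linear "pinv A" by (rule linear_pinv)
  have e: "A *v y k \<omega> - b + res k \<omega> = (A *v x k \<omega> - b + res k \<omega>) - \<Delta> k \<omega> *\<^sub>R (A *v g k \<omega>)"
    unfolding y_eq[OF \<omega>]
    by (simp add: matrix_vector_mult_diff_distrib matrix_vector_mult_scaleR)
  have "x (Suc k) \<omega> = y k \<omega> - pinv A (A *v y k \<omega> - b + res k \<omega>)"
    by (simp only: x_step[OF \<omega>] inexact_proj_def pinv_def)
  also have "\<dots> = x k \<omega> - \<Delta> k \<omega> *\<^sub>R P (g k \<omega>) - pinv A (A *v x k \<omega> - b + res k \<omega>)"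
    unfolding e pi.diff pi.scaleR nullproj_def by (simp add: y_eq[OF \<omega>] scaleR_diff_right)
  finally show ?thesis .
qed

text \<open>\<open>A\<close> annihilates the null-space component and undoes \<open>pinv A\<close>,
  so the step cancels the old infeasibility and leaves only the residual.\<close>

lemma infeasibility_Suc:
  assumes \<omega>: "\<omega> \<in> space M"
  shows "A *v x (Suc k) \<omega> - b = - res k \<omega>"
  unfolding x_Suc_eq[OF \<omega>]
  by (simp add: matrix_vector_mult_diff_distrib matrix_vector_mult_scaleR
      mult_nullproj[OF full_row_rank] mult_pinv[OF full_row_rank])

lemma infeas_nonneg: "0 \<le> infeas k"
  using \<eta>_pos \<mu>_nonneg by (induction k) auto

lemma norm_infeasibility_le:
  assumes \<omega>: "\<omega> \<in> space M"
  shows "norm (A *v x k \<omega> - b) \<le> infeas k"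
proof (induction k)
  case 0
  then show ?case using x_init[OF \<omega>] by simp
next
  case (Suc k)
  have "norm (A *v x (Suc k) \<omega> - b) \<le> \<eta>s k * norm (A *v x k \<omega> - b) + \<mu> k"
    unfolding infeasibility_Suc[OF \<omega>] norm_minus_cancel by (rule res_bound[OF \<omega>])
  also have "\<eta>s k * norm (A *v x k \<omega> - b) \<le> \<eta> * infeas k"
    using Suc \<eta>s_range[of k] \<eta>_pos by (intro mult_mono) auto
  finally show ?case by simp
qed

text \<open>Summing the recursion bounds a partial sum by a constant plus \<eta> times itself; since
  \<eta> is below 1 this term can be absorbed on the left.\<close>

lemma summable_infeas:
  assumes "summable \<mu>"
  shows "summable infeas"
proof (rule bounded_imp_summable)
  show "0 \<le> infeas k" for k by (rule infeas_nonneg)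
  fix n
  have "(\<Sum>k\<le>n. infeas k) \<le> infeas 0 + (\<Sum>k<n. \<eta> * infeas k + \<mu> k)"
    by (simp add: lessThan_Suc_atMost[symmetric] sum.lessThan_Suc_shift del: sum.lessThan_Suc)
  also have "\<dots> = infeas 0 + \<eta> * (\<Sum>k<n. infeas k) + (\<Sum>k<n. \<mu> k)"
    by (simp add: sum.distrib sum_distrib_left)
  also have "\<dots> \<le> infeas 0 + \<eta> * (\<Sum>k\<le>n. infeas k) + (\<Sum>k. \<mu> k)"
  proof (intro add_mono mult_left_mono order_refl)
    show "(\<Sum>k<n. infeas k) \<le> (\<Sum>k\<le>n. infeas k)"
      by (intro sum_mono2) (auto simp: infeas_nonneg)
    show "(\<Sum>k<n. \<mu> k) \<le> (\<Sum>k. \<mu> k)" using assms \<mu>_nonneg by (intro sum_le_suminf) auto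
  qed (use \<eta>_pos in auto)
  finally have "(1 - \<eta>) * (\<Sum>k\<le>n. infeas k) \<le> infeas 0 + (\<Sum>k. \<mu> k)"
    by (simp add: algebra_simps)
  then show "(\<Sum>k\<le>n. infeas k) \<le> (infeas 0 + (\<Sum>k. \<mu> k)) / (1 - \<eta>)"
    using \<eta>_less_1 by (simp add: field_simps)
qed

text \<open>The row-space part of a step, up to sign. Since the new infeasibility is minus the
  residual, it can be written with two consecutive infeasibilities and is then controlled by
  \<open>infeas\<close> alone.\<close>

definition corr :: "nat \<Rightarrow> 'w \<Rightarrow> real^'n" where
  "corr k \<omega> = pinv A (A *v x k \<omega> - b - (A *v x (Suc k) \<omega> - b))"

definition corr_bound :: "nat \<Rightarrow> real" where
  "corr_bound k = onorm (pinv A) * (infeas k + infeas (Suc k))"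

lemma bounded_linear_pinv: "bounded_linear (pinv A)"
  using linear_pinv by (simp add: linear_conv_bounded_linear)

lemma norm_corr_le: "\<omega> \<in> space M \<Longrightarrow> norm (corr k \<omega>) \<le> corr_bound k"
proof -
  assume \<omega>: "\<omega> \<in> space M"
  have "norm (corr k \<omega>) \<le> onorm (pinv A) * norm (A *v x k \<omega> - b - (A *v x (Suc k) \<omega> - b))"
    unfolding corr_def by (rule onorm[OF bounded_linear_pinv])
  also have "\<dots> \<le> corr_bound k"
    unfolding corr_bound_def
    using norm_infeasibility_le[OF \<omega>, of k] norm_infeasibility_le[OF \<omega>, of "Suc k"]
    by (intro mult_left_mono onorm_pos_le[OF bounded_linear_pinv]) norm
  finally show ?thesis .
qed

lemma corr_bound_nonneg: "0 \<le> corr_bound k"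
  unfolding corr_bound_def
  using infeas_nonneg[of k] infeas_nonneg[of "Suc k"]
  by (intro mult_nonneg_nonneg onorm_pos_le[OF bounded_linear_pinv]) simp

lemma step_eq:
  assumes \<omega>: "\<omega> \<in> space M"
  shows "x (Suc k) \<omega> - x k \<omega> = - (\<Delta> k \<omega> *\<^sub>R P (g k \<omega>)) - corr k \<omega>"
  unfolding corr_def infeasibility_Suc[OF \<omega>] by (simp add: x_Suc_eq[OF \<omega>])

text \<open>The residuals need not be adapted, but the null-space component of a step, which carries
  the randomness, can be read off the iterates.\<close>

lemma nullproj_step:
  assumes \<omega>: "\<omega> \<in> space M"
  shows "P (x k \<omega> - x (Suc k) \<omega>) = \<Delta> k \<omega> *\<^sub>R P (g k \<omega>)"
proof -
  interpret P: linear P by (rule linear_P)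
  have "x k \<omega> - x (Suc k) \<omega> = \<Delta> k \<omega> *\<^sub>R P (g k \<omega>) + corr k \<omega>"
    using arg_cong[OF step_eq[OF \<omega>, of k], of uminus] by simp
  then show ?thesis
    by (simp add: P.add P.scaleR nullproj_nullproj[OF full_row_rank] corr_def nullproj_pinv[OF full_row_rank])
qed

text \<open>Null-space and row-space components are orthogonal, so Pythagoras gives an identity
  without a cross term.\<close>

lemma norm_step:
  assumes \<omega>: "\<omega> \<in> space M"
  shows "(norm (x (Suc k) \<omega> - x k \<omega>))\<^sup>2 = (\<Delta> k \<omega>)\<^sup>2 * (norm (P (g k \<omega>)))\<^sup>2 + (norm (corr k \<omega>))\<^sup>2"
proof -
  have "norm (x (Suc k) \<omega> - x k \<omega>) = norm (\<Delta> k \<omega> *\<^sub>R P (g k \<omega>) + corr k \<omega>)"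
    unfolding step_eq[OF \<omega>] by (metis minus_add_distrib norm_minus_cancel diff_conv_add_uminus)
  also have "\<Delta> k \<omega> *\<^sub>R P (g k \<omega>) = P (\<Delta> k \<omega> *\<^sub>R g k \<omega>)"
    by (simp add: linear_scale[OF linear_P])
  finally have "(norm (x (Suc k) \<omega> - x k \<omega>))\<^sup>2 = (norm (P (\<Delta> k \<omega> *\<^sub>R g k \<omega>)))\<^sup>2 + (norm (corr k \<omega>))\<^sup>2"
    unfolding corr_def by (simp add: norm_nullproj_add_pinv[OF full_row_rank])
  then show ?thesis by (simp add: linear_scale[OF linear_P] power_mult_distrib)
qed

section \<open>Mini-batch gradients: measurability, boundedness and unbiasedness\<close>

lemma idx_range: "\<omega> \<in> space M \<Longrightarrow> idx k \<omega> \<in> {1..r}"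
  using measurable_space[OF idx_measurable[of k]] by simp

lemma batch_subset: "\<omega> \<in> space M \<Longrightarrow> i \<in> {1..r} \<Longrightarrow> batch k \<omega> i \<subseteq> {1..N}"
  using batch_partition[of \<omega> k] by (auto simp: partition_on_def)

lemma g_eq_G: "\<omega> \<in> space M \<Longrightarrow> g k \<omega> = G k (idx k \<omega>) \<omega>"
  by (simp add: g_eq G_def)

lemma grad_measurable: "j \<in> {1..N} \<Longrightarrow> grad (fs j) \<in> borel_measurable borel"
  using fs_C1[of j] by (auto simp: cont_diff_def intro: borel_measurable_continuous_onI)

text \<open>The index set of the sum is itself random. It takes finitely many values
  \<open>B\<close>, each on an event of the history, and for fixed \<open>B\<close> the sum is a
  continuous function of \<open>x k\<close>.\<close>

lemma G_measurable:
  assumes i: "i \<in> {1..r}"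
  shows "G k i \<in> borel_measurable (F k)"
proof -
  have ev: "{\<omega> \<in> space (F k). batch k \<omega> i = B} \<in> sets (F k)" if "B \<subseteq> {1..N}" for B
    using measurable_sets[OF batch_adapted[OF i, of k], of "{B}"] that
    by (auto simp: vimage_def Int_def conj_commute)
  have "(\<lambda>\<omega>. (real r / real N) *\<^sub>R (\<Sum>B\<in>Pow {1..N}.
      indicator {\<omega> \<in> space (F k). batch k \<omega> i = B} \<omega> *\<^sub>R (\<Sum>j\<in>B. grad (fs j) (x k \<omega>)))) \<in> borel_measurable (F k)"
    using ev
    by (intro borel_measurable_scaleR borel_measurable_const borel_measurable_sum borel_measurable_indicator
        measurable_compose[OF x_measurable_F grad_measurable]) auto
  also have "?this \<longleftrightarrow> ?thesis"
  proof (rule measurable_cong)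
    fix \<omega> assume \<omega>: "\<omega> \<in> space (F k)"
    then have sub: "batch k \<omega> i \<in> Pow {1..N}" using batch_subset[OF _ i] by (simp add: space_F)
    have "(\<Sum>B\<in>Pow {1..N}. indicator {\<omega> \<in> space (F k). batch k \<omega> i = B} \<omega> *\<^sub>R (\<Sum>j\<in>B. grad (fs j) (x k \<omega>)))
      = (\<Sum>B\<in>Pow {1..N}. if batch k \<omega> i = B then \<Sum>j\<in>B. grad (fs j) (x k \<omega>) else 0)"
      using \<omega> by (intro sum.cong) (auto simp: indicator_def)
    also have "\<dots> = (\<Sum>j\<in>batch k \<omega> i. grad (fs j) (x k \<omega>))" using sub by (subst sum.delta') auto
    finally show "(real r / real N) *\<^sub>R (\<Sum>B\<in>Pow {1..N}.
      indicator {\<omega> \<in> space (F k). batch k \<omega> i = B} \<omega> *\<^sub>R (\<Sum>j\<in>B. grad (fs j) (x k \<omega>))) = G k i \<omega>"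
      by (simp add: G_def)
  qed
  finally show ?thesis .
qed

text \<open>The batches cover \<open>{1..N}\<close>, and they are disjoint because injectivity turns
  distinct indices into distinct blocks of the partition. Hence the inner sums reassemble the full
  gradient sum.\<close>

lemma sum_G:
  assumes \<omega>: "\<omega> \<in> space M"
  shows "(\<Sum>i\<in>{1..r}. G k i \<omega>) = real r *\<^sub>R grad f (x k \<omega>)"
proof -
  have part: "partition_on {1..N} (batch k \<omega> ` {1..r})" and inj: "inj_on (batch k \<omega>) {1..r}"
    using batch_partition[OF \<omega>] by auto
  have U: "\<Union>(batch k \<omega> ` {1..r}) = {1..N}" using part by (auto simp: partition_on_def)
  have "(\<Sum>j\<in>{1..N}. grad (fs j) (x k \<omega>)) = (\<Sum>j\<in>\<Union>(batch k \<omega> ` {1..r}). grad (fs j) (x k \<omega>))"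
    unfolding U ..
  also have "\<dots> = (\<Sum>i\<in>{1..r}. \<Sum>j\<in>batch k \<omega> i. grad (fs j) (x k \<omega>))"
  proof (rule sum.UNION_disjoint)
    show "\<forall>i\<in>{1..r}. finite (batch k \<omega> i)"
      using batch_subset[OF \<omega>] finite_subset by blast
    show "\<forall>i\<in>{1..r}. \<forall>j\<in>{1..r}. i \<noteq> j \<longrightarrow> batch k \<omega> i \<inter> batch k \<omega> j = {}"
    proof (intro ballI impI)
      fix i j assume ij: "i \<in> {1..r}" "j \<in> {1..r}" "i \<noteq> j"
      then have "batch k \<omega> i \<noteq> batch k \<omega> j" using inj by (auto dest: inj_onD)
      then show "batch k \<omega> i \<inter> batch k \<omega> j = {}"
        using partition_onD2[OF part] ij by (auto simp: disjoint_def)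
    qed
  qed simp
  finally have "(\<Sum>i\<in>{1..r}. \<Sum>j\<in>batch k \<omega> i. grad (fs j) (x k \<omega>)) = real N *\<^sub>R grad f (x k \<omega>)"
    using N_pos by (subst grad_avg[OF fs_C1]) auto
  then show ?thesis
    using N_pos by (simp add: G_def scaleR_sum_right[symmetric])
qed

text \<open>For fixed \<open>k\<close> only finitely many gradients occur and the residual is bounded, hence every
  quantity is bounded and integrability is never an issue.\<close>

lemma bounded_G_of_bounded_x:
  assumes "bounded (x k ` space M)" and i: "i \<in> {1..r}"
  shows "bounded (G k i ` space M)"
proof -
  have "bounded ((\<lambda>\<omega>. (real r / real N) * (\<Sum>j\<in>{1..N}. norm (grad (fs j) (x k \<omega>)))) ` space M)"
    using fs_C1
    by (intro bounded_image_mult bounded_image_sum bounded_image_norm bounded_image_continuous[OF assms(1)])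
      (auto simp: cont_diff_def bounded_iff)
  then obtain C where C: "\<And>\<omega>. \<omega> \<in> space M \<Longrightarrow>
      norm ((real r / real N) * (\<Sum>j\<in>{1..N}. norm (grad (fs j) (x k \<omega>)))) \<le> C"
    unfolding bounded_iff by auto
  have "norm (G k i \<omega>) \<le> C" if \<omega>: "\<omega> \<in> space M" for \<omega>
  proof -
    have "norm (G k i \<omega>) \<le> (real r / real N) * (\<Sum>j\<in>batch k \<omega> i. norm (grad (fs j) (x k \<omega>)))"
      unfolding G_def norm_scaleR by (intro mult_mono norm_sum) auto
    also have "\<dots> \<le> (real r / real N) * (\<Sum>j\<in>{1..N}. norm (grad (fs j) (x k \<omega>)))"
      using batch_subset[OF \<omega> i] by (intro mult_left_mono sum_mono2) auto
    also have "\<dots> \<le> C" using C[OF \<omega>] unfolding real_norm_def by (rule abs_le_D1)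
    finally show ?thesis .
  qed
  then show ?thesis unfolding bounded_iff by auto
qed

lemma bounded_g_of_bounded_x:
  assumes "bounded (x k ` space M)"
  shows "bounded (g k ` space M)"
proof (rule bounded_subset)
  show "bounded (\<Union>i\<in>{1..r}. G k i ` space M)"
    using bounded_G_of_bounded_x[OF assms] by (intro bounded_UN) auto
  show "g k ` space M \<subseteq> (\<Union>i\<in>{1..r}. G k i ` space M)"
    using idx_range[of _ k] g_eq_G[of _ k] by blast
qed

lemma bounded_\<Delta>: "bounded (\<Delta> k ` space M)"
proof -
  have "norm (\<Delta> k \<omega>) \<le> \<alpha> k * \<delta>\<^sub>u" if "\<omega> \<in> space M" for \<omega>
    using \<Delta>_bounds(2)[OF that, of k] \<Delta>_pos[OF that, of k] by simp
  then show ?thesis unfolding bounded_iff by blast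
qed

lemma bounded_corr: "bounded (corr k ` space M)"
  unfolding bounded_iff using norm_corr_le by auto

lemma bounded_image_P: "bounded (X ` S) \<Longrightarrow> bounded ((\<lambda>s. P (X s)) ` S)"
  unfolding bounded_iff ball_simps using norm_nullproj_le[OF full_row_rank] order_trans by blast

text \<open>Induction from the deterministic start: continuous gradients are bounded on the bounded
  range of \<open>x k\<close>, the step size is bounded, and the correction has a deterministic
  bound. The bound depends on \<open>k\<close>.\<close>

lemma bounded_x: "bounded (x k ` space M)"
proof (induction k)
  case 0
  then show ?case using x_init by (auto simp: bounded_iff)
next
  case (Suc k)
  have "bounded ((\<lambda>\<omega>. x k \<omega> - (\<Delta> k \<omega> *\<^sub>R P (g k \<omega>) + corr k \<omega>)) ` space M)"
    by (intro bounded_minus_comp bounded_plus_comp bounded_image_scaleR bounded_image_P Suc bounded_\<Delta>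
        bounded_g_of_bounded_x bounded_corr)
  also have "(\<lambda>\<omega>. x k \<omega> - (\<Delta> k \<omega> *\<^sub>R P (g k \<omega>) + corr k \<omega>)) ` space M = x (Suc k) ` space M"
    using step_eq[of _ k] by (intro image_cong refl) (simp add: algebra_simps)
  finally show ?case .
qed

lemmas bounded_G = bounded_G_of_bounded_x[OF bounded_x]

lemmas bounded_g = bounded_g_of_bounded_x[OF bounded_x]

lemma g_measurable [measurable]: "g k \<in> borel_measurable M"
proof -
  have ev: "{\<omega> \<in> space M. idx k \<omega> = i} \<in> sets M" if "i \<in> {1..r}" for i
    using measurable_sets[OF idx_measurable[of k], of "{i}"] that
    by (auto simp: vimage_def Int_def conj_commute)
  have "(\<lambda>\<omega>. \<Sum>i\<in>{1..r}. indicator {\<omega> \<in> space M. idx k \<omega> = i} \<omega> *\<^sub>R G k i \<omega>) \<in> borel_measurable M"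
    using ev by (intro borel_measurable_scaleR borel_measurable_sum borel_measurable_indicator
        measurable_F_M[OF G_measurable]) auto
  also have "?this \<longleftrightarrow> ?thesis"
  proof (rule measurable_cong)
    fix \<omega> assume \<omega>: "\<omega> \<in> space M"
    have "(\<Sum>i\<in>{1..r}. indicator {\<omega> \<in> space M. idx k \<omega> = i} \<omega> *\<^sub>R G k i \<omega>)
       = (\<Sum>i\<in>{1..r}. if idx k \<omega> = i then G k i \<omega> else 0)"
      using \<omega> by (intro sum.cong) (auto simp: indicator_def)
    also have "\<dots> = g k \<omega>" using idx_range[OF \<omega>, of k] g_eq_G[OF \<omega>, of k] by (subst sum.delta') auto
    finally show "(\<Sum>i\<in>{1..r}. indicator {\<omega> \<in> space M. idx k \<omega> = i} \<omega> *\<^sub>R G k i \<omega>) = g k \<omega>" .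
  qed
  finally show ?thesis .
qed

lemma sigma_finite_F: "sigma_finite_subalgebra M (F k)"
  by (intro finite_measure_subalgebra_is_sigma_finite finite_measure_subalgebra.intro
      finite_measure_subalgebra_axioms.intro subalg) unfold_locales

text \<open>\<open>H\<close> is known given the history, so it can be pulled out of the conditional
  expectation of the indicator, which is the constant \<open>1 / real r\<close>.\<close>

lemma expectation_indicator_idx:
  assumes i: "i \<in> {1..r}" and H: "H \<in> borel_measurable (F k)" "bounded (H ` space M)"
  shows "expectation (\<lambda>\<omega>. H \<omega> * indicator {\<omega> \<in> space M. idx k \<omega> = i} \<omega>) = expectation H / real r"
proof -
  interpret S: sigma_finite_subalgebra M "F k" by (rule sigma_finite_F)
  let ?I = "indicator {\<omega> \<in> space M. idx k \<omega> = i} :: 'w \<Rightarrow> real"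
  have ev: "{\<omega> \<in> space M. idx k \<omega> = i} \<in> sets M"
    using measurable_sets[OF idx_measurable[of k], of "{i}"] i
    by (auto simp: vimage_def Int_def conj_commute)
  then have MI: "?I \<in> borel_measurable M" by auto
  have MH: "H \<in> borel_measurable M" by (rule measurable_F_M[OF H(1)])
  have "integrable M (\<lambda>\<omega>. H \<omega> * ?I \<omega>)"
    by (intro integrable_bounded_image bounded_image_mult H borel_measurable_times MH MI)
      (auto simp: bounded_iff indicator_def)
  then have "expectation (\<lambda>\<omega>. H \<omega> * ?I \<omega>) = expectation (\<lambda>\<omega>. H \<omega> * real_cond_exp M (F k) ?I \<omega>)"
    by (intro S.real_cond_exp_intg(2)[symmetric] H MI)
  also have "\<dots> = expectation (\<lambda>\<omega>. H \<omega> * (1 / real r))"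
    using idx_uniform[OF i, of k] MH by (intro integral_cong_AE) auto
  finally show ?thesis by simp
qed

text \<open>Conditional unbiasedness of \<open>g k\<close> in weak form, tested against bounded
  vectors that depend on the history: split by the drawn index, use that each index has conditional
  probability \<open>1 / real r\<close>, and average the candidates with
  \<open>sum_G\<close>.\<close>

lemma expectation_inner_g:
  assumes U: "U \<in> borel_measurable (F k)" "bounded (U ` space M)"
  shows "expectation (\<lambda>\<omega>. U \<omega> \<bullet> g k \<omega>) = expectation (\<lambda>\<omega>. U \<omega> \<bullet> grad f (x k \<omega>))"
proof -
  have meas: "(\<lambda>\<omega>. U \<omega> \<bullet> G k i \<omega>) \<in> borel_measurable (F k)" if "i \<in> {1..r}" for i
    by (intro borel_measurable_inner U G_measurable that)
  have bnd: "bounded ((\<lambda>\<omega>. U \<omega> \<bullet> G k i \<omega>) ` space M)" if "i \<in> {1..r}" for i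
    by (intro bounded_image_inner U bounded_G that)
  have ev: "{\<omega> \<in> space M. idx k \<omega> = i} \<in> sets M" if "i \<in> {1..r}" for i
    using measurable_sets[OF idx_measurable[of k], of "{i}"] that
    by (auto simp: vimage_def Int_def conj_commute)
  have "expectation (\<lambda>\<omega>. U \<omega> \<bullet> g k \<omega>) =
      expectation (\<lambda>\<omega>. \<Sum>i\<in>{1..r}. (U \<omega> \<bullet> G k i \<omega>) * indicator {\<omega> \<in> space M. idx k \<omega> = i} \<omega>)"
  proof (rule Bochner_Integration.integral_cong[OF refl])
    fix \<omega> assume \<omega>: "\<omega> \<in> space M"
    have "(\<Sum>i\<in>{1..r}. (U \<omega> \<bullet> G k i \<omega>) * indicator {\<omega> \<in> space M. idx k \<omega> = i} \<omega>)
       = (\<Sum>i\<in>{1..r}. if idx k \<omega> = i then U \<omega> \<bullet> G k i \<omega> else 0)"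
      using \<omega> by (intro sum.cong) (auto simp: indicator_def)
    also have "\<dots> = U \<omega> \<bullet> g k \<omega>" using idx_range[OF \<omega>, of k] g_eq_G[OF \<omega>, of k] by (subst sum.delta') auto
    finally show "U \<omega> \<bullet> g k \<omega> = (\<Sum>i\<in>{1..r}. (U \<omega> \<bullet> G k i \<omega>) * indicator {\<omega> \<in> space M. idx k \<omega> = i} \<omega>)" ..
  qed
  also have "\<dots> = (\<Sum>i\<in>{1..r}. expectation (\<lambda>\<omega>. (U \<omega> \<bullet> G k i \<omega>) * indicator {\<omega> \<in> space M. idx k \<omega> = i} \<omega>))"
    using ev measurable_F_M[OF meas]
    by (intro Bochner_Integration.integral_sum integrable_bounded_image bounded_image_mult bnd
        borel_measurable_times borel_measurable_indicator)
      (auto simp: bounded_iff indicator_def)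
  also have "\<dots> = (\<Sum>i\<in>{1..r}. expectation (\<lambda>\<omega>. U \<omega> \<bullet> G k i \<omega>) / real r)"
    by (intro sum.cong refl expectation_indicator_idx meas bnd)
  also have "\<dots> = expectation (\<lambda>\<omega>. \<Sum>i\<in>{1..r}. U \<omega> \<bullet> G k i \<omega> / real r)"
    using measurable_F_M[OF meas] bnd
    by (subst Bochner_Integration.integral_sum)
      (auto intro!: integrable_bounded_image integrable_divide)
  also have "\<dots> = expectation (\<lambda>\<omega>. U \<omega> \<bullet> grad f (x k \<omega>))"
  proof (rule Bochner_Integration.integral_cong[OF refl])
    fix \<omega> assume \<omega>: "\<omega> \<in> space M"
    have "(\<Sum>i\<in>{1..r}. U \<omega> \<bullet> G k i \<omega> / real r) = (U \<omega> \<bullet> (\<Sum>i\<in>{1..r}. G k i \<omega>)) / real r"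
      by (simp add: inner_sum_right sum_divide_distrib)
    also have "\<dots> = U \<omega> \<bullet> grad f (x k \<omega>)"
      unfolding sum_G[OF \<omega>] using r_pos by simp
    finally show "(\<Sum>i\<in>{1..r}. U \<omega> \<bullet> G k i \<omega> / real r) = U \<omega> \<bullet> grad f (x k \<omega>)" .
  qed
  finally show ?thesis .
qed

end

section \<open>Convergence\<close>

text \<open>Telescoping from \<open>K\<close> on: the partial sums of \<open>q\<close> are at most
  twice the total decrease of \<open>a\<close> plus the total error. The threshold \<open>K\<close>
  allows for step sizes that become small only eventually.\<close>

lemma summable_decrease:
  fixes a q \<gamma> :: "nat \<Rightarrow> real"
  assumes step: "\<And>k. K \<le> k \<Longrightarrow> a (Suc k) \<le> a k - q k / 2 + \<gamma> k"
    and lower: "\<And>k. c \<le> a k" and q: "\<And>k. 0 \<le> q k" and \<gamma>: "\<And>k. 0 \<le> \<gamma> k" "summable \<gamma>"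
  shows "summable q"
proof -
  have \<gamma>': "summable (\<lambda>k. \<gamma> (k + K))" using \<gamma> by (intro summable_ignore_initial_segment)
  have bound: "(\<Sum>k<n. q (k + K)) \<le> 2 * (a K - a (n + K) + (\<Sum>k<n. \<gamma> (k + K)))" for n
  proof (induction n)
    case (Suc n)
    then show ?case using step[of "n + K"] by simp
  qed simp
  have "summable (\<lambda>k. q (k + K))"
  proof (rule summableI_nonneg_bounded)
    fix n
    have "(\<Sum>k<n. \<gamma> (k + K)) \<le> (\<Sum>k. \<gamma> (k + K))" using \<gamma> \<gamma>' by (intro sum_le_suminf) auto
    then show "(\<Sum>k<n. q (k + K)) \<le> 2 * (a K - c + (\<Sum>k. \<gamma> (k + K)))"
      using bound[of n] lower[of "n + K"] by simp
  qed (rule q)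
  then show ?thesis by (simp add: summable_iff_shift)
qed

text \<open>If \<open>z\<close> stayed above \<epsilon> from some point on,
  \<open>\<epsilon> * \<alpha> k\<close> would be dominated by a summable sequence, against the
  divergence of the weights.\<close>

lemma frequently_small_of_weighted_summable:
  fixes \<alpha> z :: "nat \<Rightarrow> real"
  assumes \<alpha>: "\<And>k. 0 < \<alpha> k" and div: "filterlim (\<lambda>n. \<Sum>k<n. \<alpha> k) at_top sequentially"
    and sum: "summable (\<lambda>k. \<alpha> k * z k)" and \<epsilon>: "0 < \<epsilon>"
  shows "\<exists>\<^sub>F k in sequentially. z k < \<epsilon>"
proof (rule ccontr)
  assume "\<not> ?thesis"
  then have ev: "\<forall>\<^sub>F k in sequentially. \<epsilon> \<le> z k"
    by (simp add: not_frequently not_less)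
  have "summable (\<lambda>k. \<epsilon> * \<alpha> k)"
  proof (rule summable_comparison_test_ev[OF _ sum])
    show "\<forall>\<^sub>F k in sequentially. norm (\<epsilon> * \<alpha> k) \<le> \<alpha> k * z k"
      using ev by eventually_elim (use \<alpha> \<epsilon> in \<open>simp add: mult.commute less_imp_le\<close>)
  qed
  then have "summable \<alpha>" using \<epsilon> by (simp add: summable_cmult_iff)
  then have "(\<lambda>n. \<Sum>k<n. \<alpha> k) \<longlonglongrightarrow> suminf \<alpha>" by (rule summable_LIMSEQ)
  then show False
    using not_tendsto_and_filterlim_at_infinity[of sequentially "\<lambda>n. \<Sum>k<n. \<alpha> k"]
      filterlim_at_top_imp_at_infinity[OF div] by simp
qed

lemma liminf_eq_0I:
  fixes u :: "nat \<Rightarrow> real"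
  assumes "\<And>k. 0 \<le> u k" "\<And>\<epsilon>. 0 < \<epsilon> \<Longrightarrow> \<exists>\<^sub>F k in sequentially. u k < \<epsilon>"
  shows "liminf (\<lambda>k. ereal (u k)) = 0"
proof (rule antisym)
  show "0 \<le> liminf (\<lambda>k. ereal (u k))"
    using assms(1) by (intro Liminf_bounded always_eventually) auto
  show "liminf (\<lambda>k. ereal (u k)) \<le> 0"
  proof (rule ereal_le_epsilon2)
    fix \<epsilon> :: real assume "0 < \<epsilon>"
    have "liminf (\<lambda>k. ereal (u k)) \<le> ereal \<epsilon>"
    proof (rule ccontr)
      assume "\<not> ?thesis"
      then have "ereal \<epsilon> < liminf (\<lambda>k. ereal (u k))" by simp
      then have "\<forall>\<^sub>F k in sequentially. ereal \<epsilon> < ereal (u k)" by (rule less_LiminfD)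
      then have "\<forall>\<^sub>F k in sequentially. \<not> u k < \<epsilon>" by eventually_elim simp
      then show False using assms(2)[OF \<open>0 < \<epsilon>\<close>] by (simp add: frequently_def)
    qed
    then show "liminf (\<lambda>k. ereal (u k)) \<le> 0 + ereal \<epsilon>" by simp
  qed
qed

context psg_leco
begin

context
  fixes L fstar \<kappa> \<nu> :: real
  assumes f_C1: "cont_diff f"
    and L_pos: "0 < L"
    and grad_Lipschitz: "L-lipschitz_on UNIV (grad f)"
    and f_bounded_below: "\<And>z. fstar \<le> f z"
    and \<mu>_R_linear: "R_linear_to_zero \<mu>"
    and \<kappa>_pos: "0 < \<kappa>"
    and feasible_or_bounded_grad: "AE \<omega> in M.
          (\<forall>k. x k \<omega> \<in> feasible A b) \<or> (\<forall>k. norm (grad f (x k \<omega>)) \<le> \<kappa>)"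
    and \<nu>_pos: "0 < \<nu>"
    and variance_bound: "\<And>k. AE \<omega> in M. real_cond_exp M (F k)
          (\<lambda>\<omega>. (norm (g k \<omega> - grad f (x k \<omega>)))\<^sup>2) \<omega> \<le> \<nu>"
    and \<alpha>_sum_infinite: "filterlim (\<lambda>n. \<Sum>k<n. \<alpha> k) at_top sequentially"
    and \<alpha>_square_summable: "summable (\<lambda>k. (\<alpha> k)\<^sup>2)"
begin

text \<open>The conditional mean of the first-order decrease, since projecting the gradient gives
  \<open>grad f z \<bullet> P (grad f z) = (norm (P (grad f z)))\<^sup>2\<close>.\<close>

definition Q :: "nat \<Rightarrow> 'w \<Rightarrow> real" where
  "Q k \<omega> = \<Delta> k \<omega> * (norm (pgrad k \<omega>))\<^sup>2"

text \<open>Expressed by the iterates instead of \<open>g k\<close>, so that measurability with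
  respect to \<open>F (Suc k)\<close> is immediate. The form of a martingale difference is recovered
  in \<open>noise_eq\<close>.\<close>

definition noise :: "nat \<Rightarrow> 'w \<Rightarrow> real" where
  "noise k \<omega> = grad f (x k \<omega>) \<bullet> P (x k \<omega> - x (Suc k) \<omega>) - Q k \<omega>"

abbreviation dev :: "nat \<Rightarrow> 'w \<Rightarrow> real^'n" where
  "dev k \<omega> \<equiv> g k \<omega> - grad f (x k \<omega>)"

abbreviation step :: "nat \<Rightarrow> 'w \<Rightarrow> real^'n" where
  "step k \<omega> \<equiv> x (Suc k) \<omega> - x k \<omega>"

section \<open>Measurability and boundedness of the processes in the descent estimate\<close>

lemma cont_grad: "continuous_on UNIV (grad f)"
  using f_C1 by (simp add: cont_diff_def)

lemma cont_f: "continuous_on UNIV f"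
  using f_C1 by (auto simp: cont_diff_def intro!: differentiable_imp_continuous_on
      simp: differentiable_on_def intro: differentiable_at_withinI)

lemma grad_x_measurable: "j \<le> k \<Longrightarrow> (\<lambda>\<omega>. grad f (x j \<omega>)) \<in> borel_measurable (F k)"
  by (rule measurable_compose[OF x_measurable_F borel_measurable_continuous_onI[OF cont_grad]])

lemma pgrad_measurable: "j \<le> k \<Longrightarrow> pgrad j \<in> borel_measurable (F k)"
  unfolding pgrad_def[abs_def] by (rule measurable_compose[OF grad_x_measurable P_measurable])

lemma \<Delta>_measurable: "j \<le> k \<Longrightarrow> \<Delta> j \<in> borel_measurable (F k)"
  by (rule measurable_from_subalg[of "F k" "F j"])
    (auto simp: subalgebra_def space_F sets_history_mono[THEN subsetD] \<Delta>_adapted)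

lemma Q_measurable: "j \<le> k \<Longrightarrow> Q j \<in> borel_measurable (F k)"
  unfolding Q_def[abs_def]
  by (intro borel_measurable_times borel_measurable_power borel_measurable_norm[THEN measurable_compose[rotated]]
      pgrad_measurable \<Delta>_measurable)

lemma noise_measurable: "noise k \<in> borel_measurable (F (Suc k))"
  unfolding noise_def[abs_def]
  by (intro borel_measurable_diff borel_measurable_inner grad_x_measurable Q_measurable
      measurable_compose[OF _ P_measurable] x_measurable_F) auto

lemma grad_x_measurable_M [measurable]: "(\<lambda>\<omega>. grad f (x k \<omega>)) \<in> borel_measurable M"
  by (rule measurable_F_M[OF grad_x_measurable[OF order_refl]])

lemma pgrad_measurable_M [measurable]: "pgrad k \<in> borel_measurable M"
  by (rule measurable_F_M[OF pgrad_measurable[OF order_refl]])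

lemma \<Delta>_measurable_M [measurable]: "\<Delta> k \<in> borel_measurable M"
  by (rule measurable_F_M[OF \<Delta>_measurable[OF order_refl]])

lemma Q_measurable_M [measurable]: "Q k \<in> borel_measurable M"
  by (rule measurable_F_M[OF Q_measurable[OF order_refl]])

lemma noise_measurable_M [measurable]: "noise k \<in> borel_measurable M"
  by (rule measurable_F_M[OF noise_measurable])

lemma f_x_measurable_M [measurable]: "(\<lambda>\<omega>. f (x k \<omega>)) \<in> borel_measurable M"
  by (rule measurable_compose[OF x_measurable borel_measurable_continuous_onI[OF cont_f]])

declare x_measurable [measurable]

lemma bounded_f_x: "bounded ((\<lambda>\<omega>. f (x k \<omega>)) ` space M)"
  by (rule bounded_image_continuous[OF bounded_x cont_f])

lemma bounded_grad_x: "bounded ((\<lambda>\<omega>. grad f (x k \<omega>)) ` space M)"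
  by (rule bounded_image_continuous[OF bounded_x cont_grad])

lemma bounded_pgrad: "bounded (pgrad k ` space M)"
  unfolding pgrad_def[abs_def] by (rule bounded_image_P[OF bounded_grad_x])

lemma bounded_Q: "bounded (Q k ` space M)"
  unfolding Q_def[abs_def]
  by (intro bounded_image_mult bounded_image_power bounded_image_norm bounded_pgrad bounded_\<Delta>)

lemma bounded_noise: "bounded (noise k ` space M)"
  unfolding noise_def[abs_def]
  by (intro bounded_minus_comp bounded_image_inner bounded_grad_x bounded_Q bounded_image_P bounded_x)

lemma bounded_dev: "bounded (dev k ` space M)"
  by (intro bounded_minus_comp bounded_g bounded_grad_x)

lemma Q_nonneg: "\<omega> \<in> space M \<Longrightarrow> 0 \<le> Q k \<omega>"
  unfolding Q_def using \<Delta>_pos[of \<omega> k] by simp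

text \<open>The projector is self-adjoint and idempotent, so it can be moved off \<open>g k\<close>
  and off one copy of the gradient in \<open>Q k\<close>; the difference of the two inner products
  is the deviation from the mean.\<close>

lemma noise_eq:
  assumes \<omega>: "\<omega> \<in> space M"
  shows "noise k \<omega> = \<Delta> k \<omega> * (pgrad k \<omega> \<bullet> dev k \<omega>)"
proof -
  have "grad f (x k \<omega>) \<bullet> P (x k \<omega> - x (Suc k) \<omega>) = \<Delta> k \<omega> * (pgrad k \<omega> \<bullet> P (g k \<omega>))"
    unfolding nullproj_step[OF \<omega>] inner_scaleR_right pgrad_def
    by (simp add: inner_nullproj[OF full_row_rank, of "grad f (x k \<omega>)"])
  also have "pgrad k \<omega> \<bullet> P (g k \<omega>) = pgrad k \<omega> \<bullet> g k \<omega>"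
    unfolding pgrad_def by (rule inner_nullproj_left[OF full_row_rank, symmetric])
  finally have 1: "grad f (x k \<omega>) \<bullet> P (x k \<omega> - x (Suc k) \<omega>) = \<Delta> k \<omega> * (pgrad k \<omega> \<bullet> g k \<omega>)" .
  have "(norm (pgrad k \<omega>))\<^sup>2 = pgrad k \<omega> \<bullet> grad f (x k \<omega>)"
    unfolding pgrad_def power2_norm_eq_inner by (rule inner_nullproj_left[OF full_row_rank, symmetric])
  then show ?thesis unfolding noise_def Q_def 1 by (simp add: inner_diff_right right_diff_distrib)
qed

text \<open>The splitting of the step turns the first-order term of \<open>f\<close> into minus the
  sum of \<open>Q\<close>, the noise and the correction term. The upper half of the estimate drives
  the descent argument; the full absolute value is used for convergence of the function
  values.\<close>

lemma f_step:
  assumes \<omega>: "\<omega> \<in> space M"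
  shows "\<bar>f (x (Suc k) \<omega>) - f (x k \<omega>) + Q k \<omega> + noise k \<omega> + grad f (x k \<omega>) \<bullet> corr k \<omega>\<bar>
    \<le> L * (norm (step k \<omega>))\<^sup>2"
proof -
  have "grad f (x k \<omega>) \<bullet> step k \<omega> = - (grad f (x k \<omega>) \<bullet> P (x k \<omega> - x (Suc k) \<omega>)) - grad f (x k \<omega>) \<bullet> corr k \<omega>"
    unfolding step_eq[OF \<omega>] nullproj_step[OF \<omega>] by (simp add: inner_diff_right)
  also have "\<dots> = - Q k \<omega> - noise k \<omega> - grad f (x k \<omega>) \<bullet> corr k \<omega>"
    by (simp add: noise_def)
  finally show ?thesis
    using lipschitz_grad_remainder[OF f_C1 grad_Lipschitz, of "x (Suc k) \<omega>" "x k \<omega>"]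
    by (simp add: algebra_simps)
qed

lemma expectation_noise:
  assumes H: "H \<in> borel_measurable (F k)" "bounded (H ` space M)"
  shows "expectation (\<lambda>\<omega>. H \<omega> * noise k \<omega>) = 0"
proof -
  \<comment> \<open>With this choice \<open>H \<omega> * noise k \<omega> = U \<omega> \<bullet> dev
    k \<omega>\<close>, and unbiasedness of \<open>g k\<close> applies to the test vector
    \<open>U\<close>.\<close>
  define U where "U \<omega> = (H \<omega> * \<Delta> k \<omega>) *\<^sub>R pgrad k \<omega>" for \<omega>
  have U: "U \<in> borel_measurable (F k)" "bounded (U ` space M)"
    unfolding U_def[abs_def]
    by (intro borel_measurable_scaleR borel_measurable_times H \<Delta>_measurable pgrad_measurable order_refl
        bounded_image_scaleR bounded_image_mult bounded_\<Delta> bounded_pgrad)+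
  have [measurable]: "U \<in> borel_measurable M" by (rule measurable_F_M[OF U(1)])
  have i1: "integrable M (\<lambda>\<omega>. U \<omega> \<bullet> g k \<omega>)"
    by (intro integrable_bounded_image bounded_image_inner U bounded_g) auto
  have i2: "integrable M (\<lambda>\<omega>. U \<omega> \<bullet> grad f (x k \<omega>))"
    by (intro integrable_bounded_image bounded_image_inner U bounded_grad_x) auto
  have "expectation (\<lambda>\<omega>. H \<omega> * noise k \<omega>) = expectation (\<lambda>\<omega>. U \<omega> \<bullet> g k \<omega> - U \<omega> \<bullet> grad f (x k \<omega>))"
    by (intro Bochner_Integration.integral_cong refl) (simp add: noise_eq U_def inner_diff_right algebra_simps)
  also have "\<dots> = 0" using i1 i2 expectation_inner_g[OF U] by simp
  finally show ?thesis .
qed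

text \<open>The factor \<open>H\<close> passes through the conditional expectation, and its
  nonnegativity preserves the almost sure bound on the conditional variance.\<close>

lemma expectation_dev:
  assumes H: "H \<in> borel_measurable (F k)" "bounded (H ` space M)" "\<And>\<omega>. \<omega> \<in> space M \<Longrightarrow> 0 \<le> H \<omega>"
  shows "expectation (\<lambda>\<omega>. H \<omega> * (norm (dev k \<omega>))\<^sup>2) \<le> \<nu> * expectation H"
proof -
  interpret S: sigma_finite_subalgebra M "F k" by (rule sigma_finite_F)
  have MH [measurable]: "H \<in> borel_measurable M" by (rule measurable_F_M[OF H(1)])
  have int: "integrable M (\<lambda>\<omega>. H \<omega> * (norm (dev k \<omega>))\<^sup>2)"
    by (intro integrable_bounded_image bounded_image_mult bounded_image_power bounded_image_norm
        bounded_dev H) auto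
  note C = S.real_cond_exp_intg[OF int H(1)]
  have "expectation (\<lambda>\<omega>. H \<omega> * (norm (dev k \<omega>))\<^sup>2)
      = expectation (\<lambda>\<omega>. H \<omega> * real_cond_exp M (F k) (\<lambda>\<omega>. (norm (dev k \<omega>))\<^sup>2) \<omega>)"
    by (rule C(2)[symmetric]) measurable
  also have "\<dots> \<le> expectation (\<lambda>\<omega>. H \<omega> * \<nu>)"
  proof (rule integral_mono_AE)
    show "integrable M (\<lambda>\<omega>. H \<omega> * real_cond_exp M (F k) (\<lambda>\<omega>. (norm (dev k \<omega>))\<^sup>2) \<omega>)"
      by (rule C(1)) measurable
    show "integrable M (\<lambda>\<omega>. H \<omega> * \<nu>)" by (intro integrable_mult_left integrable_bounded_image H MH)
    show "AE \<omega> in M. H \<omega> * real_cond_exp M (F k) (\<lambda>\<omega>. (norm (dev k \<omega>))\<^sup>2) \<omega> \<le> H \<omega> * \<nu>"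
      using variance_bound[of k] AE_space by eventually_elim (use H(3) in \<open>simp add: mult_left_mono\<close>)
  qed
  finally show ?thesis by (simp add: mult.commute)
qed

lemma \<Delta>_square_le: "\<omega> \<in> space M \<Longrightarrow> (\<Delta> k \<omega>)\<^sup>2 \<le> (\<alpha> k * \<delta>\<^sub>u)\<^sup>2"
  using \<Delta>_bounds(2)[of \<omega> k] \<Delta>_pos[of \<omega> k] by (intro power_mono) auto

text \<open>One factor \<open>\<Delta> k\<close> is replaced by its upper bound and the other stays
  inside \<open>Q k\<close>. In the feasible alternative the gradients have no uniform bound, so
  their squares must be controlled by \<open>Q\<close>.\<close>

lemma \<Delta>_square_pgrad_le:
  "\<omega> \<in> space M \<Longrightarrow> (\<Delta> k \<omega>)\<^sup>2 * (norm (pgrad k \<omega>))\<^sup>2 \<le> \<alpha> k * \<delta>\<^sub>u * Q k \<omega>"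
  using mult_right_mono[OF \<Delta>_bounds(2)[of \<omega> k] Q_nonneg[of \<omega> k]]
  by (simp add: Q_def power2_eq_square mult.assoc)

lemma integrable_Q: "integrable M (Q k)"
  by (intro integrable_bounded_image bounded_Q) auto

text \<open>Cauchy-Schwarz separates the history-dependent factor from the deviation; the variance
  bound handles the latter, and the former is a small multiple of \<open>Q k\<close>.\<close>

lemma expectation_noise_square:
  "expectation (\<lambda>\<omega>. (noise k \<omega>)\<^sup>2) \<le> \<nu> * (\<alpha> k * \<delta>\<^sub>u * expectation (Q k))"
proof -
  let ?H = "\<lambda>\<omega>. (\<Delta> k \<omega>)\<^sup>2 * (norm (pgrad k \<omega>))\<^sup>2"
  have bH: "bounded (?H ` space M)"
    by (intro bounded_image_mult bounded_image_power bounded_image_norm bounded_pgrad bounded_\<Delta>)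
  have mH: "?H \<in> borel_measurable (F k)"
    by (intro borel_measurable_times borel_measurable_power borel_measurable_norm[THEN measurable_compose[rotated]]
      pgrad_measurable \<Delta>_measurable order_refl)
  have "expectation (\<lambda>\<omega>. (noise k \<omega>)\<^sup>2) \<le> expectation (\<lambda>\<omega>. ?H \<omega> * (norm (dev k \<omega>))\<^sup>2)"
  proof (rule integral_mono)
    show "integrable M (\<lambda>\<omega>. (noise k \<omega>)\<^sup>2)"
      by (intro integrable_bounded_image bounded_image_power bounded_noise) auto
    show "integrable M (\<lambda>\<omega>. ?H \<omega> * (norm (dev k \<omega>))\<^sup>2)"
      by (intro integrable_bounded_image bounded_image_mult bounded_image_power bounded_image_norm
          bounded_dev bounded_pgrad bounded_\<Delta>) auto
    fix \<omega> assume \<omega>: "\<omega> \<in> space M"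
    have "(pgrad k \<omega> \<bullet> dev k \<omega>)\<^sup>2 \<le> (norm (pgrad k \<omega>))\<^sup>2 * (norm (dev k \<omega>))\<^sup>2"
      using Cauchy_Schwarz_ineq[of "pgrad k \<omega>" "dev k \<omega>"] by (simp add: power2_norm_eq_inner)
    then show "(noise k \<omega>)\<^sup>2 \<le> ?H \<omega> * (norm (dev k \<omega>))\<^sup>2"
      unfolding noise_eq[OF \<omega>] power_mult_distrib mult.assoc by (intro mult_left_mono) auto
  qed
  also have "\<dots> \<le> \<nu> * expectation ?H"
    by (rule expectation_dev[OF mH bH]) simp
  also have "expectation ?H \<le> expectation (\<lambda>\<omega>. \<alpha> k * \<delta>\<^sub>u * Q k \<omega>)"
    using measurable_F_M[OF mH]
    by (intro integral_mono integrable_bounded_image[OF bH] \<Delta>_square_pgrad_le integrable_mult_right integrable_Q)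
  finally show ?thesis using \<nu>_pos by (simp add: mult_left_mono)
qed

lemma integrable_step_square: "integrable M (\<lambda>\<omega>. (norm (step k \<omega>))\<^sup>2)"
  by (intro integrable_bounded_image bounded_image_power bounded_image_norm bounded_minus_comp bounded_x)
    measurable

text \<open>The factors 2 come from
  \<open>(a + b)\<^sup>2 \<le> 2 * a\<^sup>2 + 2 * b\<^sup>2\<close>, applied to the mean and the
  deviation of the projected stochastic gradient. The correction enters separately through
  \<open>norm_step\<close>.\<close>

lemma expectation_step_square:
  "expectation (\<lambda>\<omega>. (norm (step k \<omega>))\<^sup>2)
    \<le> 2 * (\<alpha> k * \<delta>\<^sub>u * expectation (Q k)) + 2 * (\<nu> * (\<alpha> k * \<delta>\<^sub>u)\<^sup>2) + (corr_bound k)\<^sup>2"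
proof -
  have mD: "(\<lambda>\<omega>. (\<Delta> k \<omega>)\<^sup>2) \<in> borel_measurable (F k)"
    by (intro borel_measurable_power \<Delta>_measurable order_refl)
  have bD: "bounded ((\<lambda>\<omega>. (\<Delta> k \<omega>)\<^sup>2) ` space M)"
    by (intro bounded_image_power bounded_\<Delta>)
  have iD: "integrable M (\<lambda>\<omega>. (\<Delta> k \<omega>)\<^sup>2 * (norm (dev k \<omega>))\<^sup>2)"
    by (intro integrable_bounded_image bounded_image_mult bounded_image_power bounded_image_norm
        bounded_dev bounded_\<Delta>) auto
  have "expectation (\<lambda>\<omega>. (norm (step k \<omega>))\<^sup>2)
     \<le> expectation (\<lambda>\<omega>. 2 * (\<alpha> k * \<delta>\<^sub>u * Q k \<omega>) + 2 * ((\<Delta> k \<omega>)\<^sup>2 * (norm (dev k \<omega>))\<^sup>2) + (corr_bound k)\<^sup>2)"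
  proof (rule integral_mono)
    show "integrable M (\<lambda>\<omega>. 2 * (\<alpha> k * \<delta>\<^sub>u * Q k \<omega>) + 2 * ((\<Delta> k \<omega>)\<^sup>2 * (norm (dev k \<omega>))\<^sup>2) + (corr_bound k)\<^sup>2)"
      using iD integrable_Q by simp
    fix \<omega> assume \<omega>: "\<omega> \<in> space M"
    have "P (g k \<omega>) = pgrad k \<omega> + P (dev k \<omega>)"
      unfolding pgrad_def by (simp add: linear_add[OF linear_P, symmetric])
    then have "norm (P (g k \<omega>)) \<le> norm (pgrad k \<omega>) + norm (dev k \<omega>)"
      using norm_triangle_ineq[of "pgrad k \<omega>" "P (dev k \<omega>)"]
        norm_nullproj_le[OF full_row_rank, of "dev k \<omega>"] by simp
    then have "(norm (P (g k \<omega>)))\<^sup>2 \<le> (norm (pgrad k \<omega>) + norm (dev k \<omega>))\<^sup>2"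
      by (intro power_mono) auto
    also have "\<dots> \<le> 2 * (norm (pgrad k \<omega>))\<^sup>2 + 2 * (norm (dev k \<omega>))\<^sup>2"
      using zero_le_power2[of "norm (pgrad k \<omega>) - norm (dev k \<omega>)"]
      by (simp add: power2_sum power2_diff)
    finally have "(\<Delta> k \<omega>)\<^sup>2 * (norm (P (g k \<omega>)))\<^sup>2
       \<le> (\<Delta> k \<omega>)\<^sup>2 * (2 * (norm (pgrad k \<omega>))\<^sup>2 + 2 * (norm (dev k \<omega>))\<^sup>2)"
      by (intro mult_left_mono) auto
    also have "\<dots> = 2 * ((\<Delta> k \<omega>)\<^sup>2 * (norm (pgrad k \<omega>))\<^sup>2) + 2 * ((\<Delta> k \<omega>)\<^sup>2 * (norm (dev k \<omega>))\<^sup>2)"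
      by (simp add: algebra_simps)
    also have "\<dots> \<le> 2 * (\<alpha> k * \<delta>\<^sub>u * Q k \<omega>) + 2 * ((\<Delta> k \<omega>)\<^sup>2 * (norm (dev k \<omega>))\<^sup>2)"
      using \<Delta>_square_pgrad_le[OF \<omega>, of k] by simp
    finally show "(norm (step k \<omega>))\<^sup>2
       \<le> 2 * (\<alpha> k * \<delta>\<^sub>u * Q k \<omega>) + 2 * ((\<Delta> k \<omega>)\<^sup>2 * (norm (dev k \<omega>))\<^sup>2) + (corr_bound k)\<^sup>2"
      unfolding norm_step[OF \<omega>]
      using power_mono[OF norm_corr_le[OF \<omega>, of k], of 2] by simp
  qed (rule integrable_step_square)
  also have "\<dots> = 2 * (\<alpha> k * \<delta>\<^sub>u * expectation (Q k))
      + 2 * expectation (\<lambda>\<omega>. (\<Delta> k \<omega>)\<^sup>2 * (norm (dev k \<omega>))\<^sup>2) + (corr_bound k)\<^sup>2"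
    using iD integrable_Q[of k] by (simp add: prob_space)
  also have "expectation (\<lambda>\<omega>. (\<Delta> k \<omega>)\<^sup>2 * (norm (dev k \<omega>))\<^sup>2) \<le> \<nu> * (\<alpha> k * \<delta>\<^sub>u)\<^sup>2"
  proof -
    have "expectation (\<lambda>\<omega>. (\<Delta> k \<omega>)\<^sup>2 * (norm (dev k \<omega>))\<^sup>2) \<le> \<nu> * expectation (\<lambda>\<omega>. (\<Delta> k \<omega>)\<^sup>2)"
      by (rule expectation_dev[OF mD bD]) simp
    also have "expectation (\<lambda>\<omega>. (\<Delta> k \<omega>)\<^sup>2) \<le> expectation (\<lambda>\<omega>. (\<alpha> k * \<delta>\<^sub>u)\<^sup>2)"
      using measurable_F_M[OF mD]
      by (intro integral_mono integrable_bounded_image[OF bD] \<Delta>_square_le) auto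
    finally show ?thesis using \<nu>_pos by (simp add: mult_left_mono prob_space)
  qed
  finally show ?thesis by simp
qed

text \<open>Either all iterates are feasible and the correction vanishes identically, or the
  gradients are bounded by \<kappa>. Which case holds may vary with the sample point.\<close>

lemma AE_grad_corr: "AE \<omega> in M. \<forall>k. \<bar>grad f (x k \<omega>) \<bullet> corr k \<omega>\<bar> \<le> \<kappa> * corr_bound k"
  using feasible_or_bounded_grad AE_space
proof eventually_elim
  case (elim \<omega>)
  show ?case
  proof
    fix k
    from elim(1) show "\<bar>grad f (x k \<omega>) \<bullet> corr k \<omega>\<bar> \<le> \<kappa> * corr_bound k"
    proof
      assume "\<forall>k. x k \<omega> \<in> feasible A b"
      then have "corr k \<omega> = 0"
        unfolding corr_def feasible_def by (simp add: linear_0[OF linear_pinv])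
      then show ?thesis using \<kappa>_pos corr_bound_nonneg by simp
    next
      assume "\<forall>k. norm (grad f (x k \<omega>)) \<le> \<kappa>"
      then have "norm (grad f (x k \<omega>)) * norm (corr k \<omega>) \<le> \<kappa> * corr_bound k"
        using norm_corr_le[OF elim(2)] \<kappa>_pos by (intro mult_mono) auto
      then show ?thesis using Cauchy_Schwarz_ineq2 order_trans by blast
    qed
  qed
qed

lemma expectation_f_step:
  "expectation (\<lambda>\<omega>. f (x (Suc k) \<omega>)) \<le> expectation (\<lambda>\<omega>. f (x k \<omega>)) - expectation (Q k)
    + \<kappa> * corr_bound k + L * expectation (\<lambda>\<omega>. (norm (step k \<omega>))\<^sup>2)"
proof -
  have if': "integrable M (\<lambda>\<omega>. f (x k \<omega>))" for k
    by (intro integrable_bounded_image bounded_f_x) auto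
  have inoise: "integrable M (noise k)"
    by (intro integrable_bounded_image bounded_noise) auto
  \<comment> \<open>Orthogonality to the constant test function 1.\<close>
  have noise0: "expectation (noise k) = 0"
    using expectation_noise[of "\<lambda>_. 1" k] by (auto simp: bounded_iff)
  have "expectation (\<lambda>\<omega>. f (x (Suc k) \<omega>)) \<le> expectation (\<lambda>\<omega>. f (x k \<omega>) - Q k \<omega> - noise k \<omega>
      + \<kappa> * corr_bound k + L * (norm (step k \<omega>))\<^sup>2)"
  proof (rule integral_mono_AE)
    show "integrable M (\<lambda>\<omega>. f (x k \<omega>) - Q k \<omega> - noise k \<omega>
      + \<kappa> * corr_bound k + L * (norm (step k \<omega>))\<^sup>2)"
      using if' integrable_Q inoise integrable_step_square by simp
    show "AE \<omega> in M. f (x (Suc k) \<omega>) \<le> f (x k \<omega>) - Q k \<omega> - noise k \<omega>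
      + \<kappa> * corr_bound k + L * (norm (step k \<omega>))\<^sup>2"
      using AE_grad_corr AE_space
    proof eventually_elim
      case (elim \<omega>)
      then show ?case using f_step[of \<omega> k] spec[OF elim(1), of k] by linarith
    qed
  qed (rule if')
  also have "\<dots> = expectation (\<lambda>\<omega>. f (x k \<omega>)) - expectation (Q k)
    + \<kappa> * corr_bound k + L * expectation (\<lambda>\<omega>. (norm (step k \<omega>))\<^sup>2)"
    using if'[of k] integrable_Q[of k] inoise integrable_step_square[of k] by (simp add: noise0 prob_space)
  finally show ?thesis .
qed

section \<open>Summability of the error terms and of the expected decrease\<close>

lemma summable_infeas': "summable infeas"
proof (rule summable_infeas)
  obtain C \<rho> where "0 < \<rho>" "\<rho> < 1" and C: "\<And>k. \<mu> k \<le> C * \<rho> ^ k"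
    using \<mu>_R_linear unfolding R_linear_to_zero_def by auto
  then have "summable (\<lambda>k. C * \<rho> ^ k)" by (intro summable_mult summable_geometric) simp
  then show "summable \<mu>"
    by (rule summable_comparison_test'[where N=0]) (use C \<mu>_nonneg in simp)
qed

lemma summable_corr_bound: "summable corr_bound"
  unfolding corr_bound_def[abs_def]
  by (intro summable_mult summable_add summable_infeas') (subst summable_Suc_iff, rule summable_infeas')

lemma summable_corr_bound_square: "summable (\<lambda>k. (corr_bound k)\<^sup>2)"
proof (rule summable_comparison_test_ev[OF _ summable_corr_bound])
  have "corr_bound \<longlonglongrightarrow> 0" by (rule summable_LIMSEQ_zero[OF summable_corr_bound])
  then have "\<forall>\<^sub>F k in sequentially. corr_bound k < 1" by (rule order_tendstoD) simp
  then show "\<forall>\<^sub>F k in sequentially. norm ((corr_bound k)\<^sup>2) \<le> corr_bound k"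
    by eventually_elim
      (use corr_bound_nonneg in \<open>simp add: power2_eq_square mult_left_le_one_le\<close>)
qed

lemma \<alpha>_tendsto_0: "\<alpha> \<longlonglongrightarrow> 0"
proof -
  have "(\<lambda>k. sqrt ((\<alpha> k)\<^sup>2)) \<longlonglongrightarrow> sqrt 0"
    by (intro tendsto_real_sqrt summable_LIMSEQ_zero \<alpha>_square_summable)
  then show ?thesis using \<alpha>_pos by (simp add: less_imp_le)
qed

lemma expectation_Q_nonneg: "0 \<le> expectation (Q k)"
  by (intro integral_nonneg_AE AE_I2 Q_nonneg)

text \<open>The squared step contributes a multiple of \<open>expectation (Q k)\<close> whose factor
  tends to zero with the step sizes. Once
  \<open>2 * L * \<delta>\<^sub>u * \<alpha> k < 1 / 2\<close>, half of the decrease absorbs it and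
  only the summable error \<gamma> remains.\<close>

lemma summable_expectation_Q: "summable (\<lambda>k. expectation (Q k))"
proof -
  define \<gamma> where "\<gamma> k = \<kappa> * corr_bound k + L * (2 * (\<nu> * (\<alpha> k * \<delta>\<^sub>u)\<^sup>2) + (corr_bound k)\<^sup>2)" for k
  have "(\<lambda>k. 2 * L * \<delta>\<^sub>u * \<alpha> k) \<longlonglongrightarrow> 2 * L * \<delta>\<^sub>u * 0" by (intro tendsto_mult \<alpha>_tendsto_0 tendsto_const)
  then have "\<forall>\<^sub>F k in sequentially. 2 * L * \<delta>\<^sub>u * \<alpha> k < 1 / 2" by (rule order_tendstoD) simp
  then obtain K where K: "\<And>k. K \<le> k \<Longrightarrow> 2 * L * \<delta>\<^sub>u * \<alpha> k < 1 / 2"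
    unfolding eventually_sequentially by auto
  show ?thesis
  proof (rule summable_decrease[where a = "\<lambda>k. expectation (\<lambda>\<omega>. f (x k \<omega>))" and K = K and \<gamma> = \<gamma> and c = fstar])
    fix k assume "K \<le> k"
    have "L * expectation (\<lambda>\<omega>. (norm (step k \<omega>))\<^sup>2)
      \<le> L * (2 * (\<alpha> k * \<delta>\<^sub>u * expectation (Q k)) + 2 * (\<nu> * (\<alpha> k * \<delta>\<^sub>u)\<^sup>2) + (corr_bound k)\<^sup>2)"
      using L_pos by (intro mult_left_mono expectation_step_square) simp
    also have "\<dots> = 2 * L * \<delta>\<^sub>u * \<alpha> k * expectation (Q k) + L * (2 * (\<nu> * (\<alpha> k * \<delta>\<^sub>u)\<^sup>2) + (corr_bound k)\<^sup>2)"
      by (simp add: algebra_simps)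
    also have "2 * L * \<delta>\<^sub>u * \<alpha> k * expectation (Q k) \<le> 1 / 2 * expectation (Q k)"
      using K[OF \<open>K \<le> k\<close>] by (intro mult_right_mono expectation_Q_nonneg) simp
    finally show "expectation (\<lambda>\<omega>. f (x (Suc k) \<omega>))
        \<le> expectation (\<lambda>\<omega>. f (x k \<omega>)) - expectation (Q k) / 2 + \<gamma> k"
      using expectation_f_step[of k] by (simp add: \<gamma>_def)
  next
    fix k
    have "expectation (\<lambda>_. fstar) \<le> expectation (\<lambda>\<omega>. f (x k \<omega>))"
      by (intro integral_mono integrable_bounded_image[OF bounded_f_x] f_bounded_below) auto
    then show "fstar \<le> expectation (\<lambda>\<omega>. f (x k \<omega>))" by (simp add: prob_space)
    show "0 \<le> \<gamma> k" unfolding \<gamma>_def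
      using \<kappa>_pos L_pos \<nu>_pos corr_bound_nonneg[of k] by simp
    show "summable \<gamma>" unfolding \<gamma>_def[abs_def] power_mult_distrib
      by (intro summable_add summable_mult summable_mult2 summable_corr_bound summable_corr_bound_square
          \<alpha>_square_summable)
  qed (rule expectation_Q_nonneg)
qed

lemma summable_\<alpha>_expectation_Q: "summable (\<lambda>k. \<alpha> k * \<delta>\<^sub>u * expectation (Q k))"
proof (rule summable_comparison_test_ev[OF _ summable_expectation_Q])
  have "(\<lambda>k. \<alpha> k * \<delta>\<^sub>u) \<longlonglongrightarrow> 0 * \<delta>\<^sub>u" by (intro tendsto_mult \<alpha>_tendsto_0 tendsto_const)
  then have "\<forall>\<^sub>F k in sequentially. \<alpha> k * \<delta>\<^sub>u < 1" by (rule order_tendstoD) simp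
  then show "\<forall>\<^sub>F k in sequentially. norm (\<alpha> k * \<delta>\<^sub>u * expectation (Q k)) \<le> expectation (Q k)"
  proof eventually_elim
    case (elim k)
    have "0 \<le> \<alpha> k * \<delta>\<^sub>u" using \<alpha>_pos[of k] \<delta>\<^sub>l_pos \<delta>\<^sub>l_less_\<delta>\<^sub>u by simp
    then show ?case
      using elim expectation_Q_nonneg[of k] by (simp add: abs_mult mult_left_le_one_le)
  qed
qed

lemma AE_summable_Q: "AE \<omega> in M. summable (\<lambda>k. Q k \<omega>)"
  by (intro AE_summable_of_summable_expectation integrable_Q Q_nonneg summable_expectation_Q)

lemma AE_summable_step: "AE \<omega> in M. summable (\<lambda>k. (norm (step k \<omega>))\<^sup>2)"
proof (rule AE_summable_of_summable_expectation[OF integrable_step_square])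
  show "summable (\<lambda>k. expectation (\<lambda>\<omega>. (norm (step k \<omega>))\<^sup>2))"
  proof (rule summable_comparison_test'[where N=0])
    show "summable (\<lambda>k. 2 * (\<alpha> k * \<delta>\<^sub>u * expectation (Q k)) + 2 * (\<nu> * (\<alpha> k * \<delta>\<^sub>u)\<^sup>2) + (corr_bound k)\<^sup>2)"
      unfolding power_mult_distrib
      by (intro summable_add summable_mult summable_mult2 summable_corr_bound_square
          \<alpha>_square_summable summable_\<alpha>_expectation_Q)
    show "norm (expectation (\<lambda>\<omega>. (norm (step k \<omega>))\<^sup>2))
      \<le> 2 * (\<alpha> k * \<delta>\<^sub>u * expectation (Q k)) + 2 * (\<nu> * (\<alpha> k * \<delta>\<^sub>u)\<^sup>2) + (corr_bound k)\<^sup>2" for k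
      using expectation_step_square[of k] by simp
  qed
qed simp

text \<open>The variances are dominated by a constant times
  \<open>\<alpha> k * \<delta>\<^sub>u * expectation (Q k)\<close>, which is summable, so the
  martingale convergence theorem above applies.\<close>

lemma AE_summable_noise: "AE \<omega> in M. summable (\<lambda>k. noise k \<omega>)"
proof -
  interpret D: bounded_martingale_differences M F noise
    by unfold_locales
      (fact subalg sets_history_mono noise_measurable bounded_noise expectation_noise)+
  show ?thesis
  proof (rule D.AE_summable, rule summable_comparison_test'[where N=0])
    show "summable (\<lambda>k. \<nu> * (\<alpha> k * \<delta>\<^sub>u * expectation (Q k)))"
      by (intro summable_mult summable_\<alpha>_expectation_Q)
    show "norm (expectation (\<lambda>\<omega>. (noise k \<omega>)\<^sup>2)) \<le> \<nu> * (\<alpha> k * \<delta>\<^sub>u * expectation (Q k))" for k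
      using expectation_noise_square[of k] by simp
  qed
qed

text \<open>The direction splits into the projected gradient, which becomes small only infinitely
  often, and the infeasibility term, which tends to zero along the whole sequence.\<close>

lemma search_dir_eq: "search_dir A b f z = - P (grad f z) - pinv A (A *v z - b)"
proof -
  interpret pi: linear "pinv A" by (rule linear_pinv)
  have "search_dir A b f z = - grad f z - pinv A (A *v (z - grad f z) - b)"
    by (simp only: search_dir_def proj_def pinv_def) simp
  also have "A *v (z - grad f z) - b = (A *v z - b) - A *v grad f z"
    by (simp add: matrix_vector_mult_diff_distrib)
  finally show ?thesis by (simp add: pi.diff nullproj_def)
qed

lemma convergence:
  "AE \<omega> in M. liminf (\<lambda>k. ereal (norm (search_dir A b f (x k \<omega>)))) = 0 \<and> convergent (\<lambda>k. f (x k \<omega>))"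
  using AE_summable_Q AE_summable_step AE_summable_noise AE_grad_corr AE_space
proof eventually_elim
  case (elim \<omega>)
  note \<omega> = elim(5)
  \<comment> \<open>The increment is the expansion remainder, dominated by the squared steps, minus
    the correction, noise and \<open>Q\<close> terms; each of the four series converges at this
    sample point.\<close>
  have "summable (\<lambda>k. f (x (Suc k) \<omega>) - f (x k \<omega>))"
  proof -
    have corr: "summable (\<lambda>k. grad f (x k \<omega>) \<bullet> corr k \<omega>)"
      by (rule summable_comparison_test'[where N=0, OF summable_mult[OF summable_corr_bound, of \<kappa>]])
        (use elim(4) in simp)
    have rem: "summable (\<lambda>k. f (x (Suc k) \<omega>) - f (x k \<omega>) + Q k \<omega> + noise k \<omega> + grad f (x k \<omega>) \<bullet> corr k \<omega>)"
      by (rule summable_comparison_test'[where N=0, OF summable_mult[OF elim(2), of L]])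
        (use f_step[OF \<omega>] in simp)
    show ?thesis
      using summable_diff[OF summable_diff[OF summable_diff[OF rem corr] elim(3)] elim(1)] by simp
  qed
  then have conv: "convergent (\<lambda>k. f (x k \<omega>))"
  proof -
    assume "summable (\<lambda>k. f (x (Suc k) \<omega>) - f (x k \<omega>))"
    then have "convergent (\<lambda>n. \<Sum>k<n. f (x (Suc k) \<omega>) - f (x k \<omega>))"
      by (simp add: summable_iff_convergent)
    then have "convergent (\<lambda>n. f (x n \<omega>) - f (x 0 \<omega>))"
      by (simp only: sum_lessThan_telescope[of "\<lambda>k. f (x k \<omega>)"])
    then show ?thesis by (simp add: convergent_diff_const_right_iff)
  qed
  have "liminf (\<lambda>k. ereal (norm (search_dir A b f (x k \<omega>)))) = 0"
  proof (rule liminf_eq_0I)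
    fix \<epsilon> :: real assume \<epsilon>: "0 < \<epsilon>"
    \<comment> \<open>The lower bound \<open>\<alpha> k * \<delta>\<^sub>l\<close> on the step size
      converts summability of \<open>Q\<close> into a series weighted by the divergent
      \<alpha>.\<close>
    have "summable (\<lambda>k. \<alpha> k * (norm (pgrad k \<omega>))\<^sup>2)"
    proof (rule summable_comparison_test'[where N=0, OF summable_divide[OF elim(1), of \<delta>\<^sub>l]])
      fix k
      have "\<alpha> k * \<delta>\<^sub>l * (norm (pgrad k \<omega>))\<^sup>2 \<le> Q k \<omega>"
        unfolding Q_def by (intro mult_right_mono \<Delta>_bounds \<omega>) simp
      then show "norm (\<alpha> k * (norm (pgrad k \<omega>))\<^sup>2) \<le> Q k \<omega> / \<delta>\<^sub>l"
        using \<delta>\<^sub>l_pos \<alpha>_pos[of k] by (simp add: field_simps abs_mult)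
    qed
    then have fr: "\<exists>\<^sub>F k in sequentially. (norm (pgrad k \<omega>))\<^sup>2 < (\<epsilon> / 2)\<^sup>2"
      using \<epsilon> by (intro frequently_small_of_weighted_summable[OF \<alpha>_pos \<alpha>_sum_infinite]) auto
    have "(\<lambda>k. onorm (pinv A) * infeas k) \<longlonglongrightarrow> onorm (pinv A) * 0"
      by (intro tendsto_mult tendsto_const summable_LIMSEQ_zero summable_infeas')
    then have ev: "\<forall>\<^sub>F k in sequentially. onorm (pinv A) * infeas k < \<epsilon> / 2"
      using \<epsilon> by (intro order_tendstoD) auto
    show "\<exists>\<^sub>F k in sequentially. norm (search_dir A b f (x k \<omega>)) < \<epsilon>"
    \<comment> \<open>An event that occurs infinitely often meets one that holds eventually, so both
      halves of \<epsilon> are available at infinitely many common indices.\<close>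
    proof (rule frequently_elim1[OF frequently_eventually_conj[OF fr ev]])
      fix k assume k: "onorm (pinv A) * infeas k < \<epsilon> / 2 \<and> (norm (pgrad k \<omega>))\<^sup>2 < (\<epsilon> / 2)\<^sup>2"
      then have 1: "norm (pgrad k \<omega>) < \<epsilon> / 2"
        using \<epsilon> by (auto intro: power2_less_imp_less[of "norm (pgrad k \<omega>)" "\<epsilon> / 2"] simp del: less_divide_eq_numeral1)
      have "norm (pinv A (A *v x k \<omega> - b)) \<le> onorm (pinv A) * norm (A *v x k \<omega> - b)"
        by (rule onorm[OF bounded_linear_pinv])
      also have "\<dots> \<le> onorm (pinv A) * infeas k"
        by (intro mult_left_mono norm_infeasibility_le \<omega> onorm_pos_le bounded_linear_pinv)
      finally have 2: "norm (pinv A (A *v x k \<omega> - b)) < \<epsilon> / 2" using k by simp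
      have "norm (search_dir A b f (x k \<omega>)) \<le> norm (pgrad k \<omega>) + norm (pinv A (A *v x k \<omega> - b))"
        unfolding search_dir_eq pgrad_def by norm
      then show "norm (search_dir A b f (x k \<omega>)) < \<epsilon>" using 1 2 by simp
    qed
  qed simp
  then show ?case using conv by simp
qed

end

end

theorem theorem2:
  fixes M :: "'w measure"
    and N r :: nat
    and fs :: "nat \<Rightarrow> real^'n \<Rightarrow> real"
    and f :: "real^'n \<Rightarrow> real"
    and A :: "real^'n^'m"
    and b :: "real^'m"
    and x\<^sub>0 :: "real^'n"
    and \<alpha> \<eta>s \<mu> :: "nat \<Rightarrow> real"
    and \<eta> \<delta>\<^sub>l \<delta>\<^sub>u \<Delta>\<^sub>0 L fstar \<kappa> \<nu> :: real
    and batch :: "nat \<Rightarrow> 'w \<Rightarrow> nat \<Rightarrow> nat set"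
    and idx :: "nat \<Rightarrow> 'w \<Rightarrow> nat"
    and g y x :: "nat \<Rightarrow> 'w \<Rightarrow> real^'n"
    and res :: "nat \<Rightarrow> 'w \<Rightarrow> real^'m"
    and \<delta> \<Delta> :: "nat \<Rightarrow> 'w \<Rightarrow> real"
  assumes alg: "psg_leco M N fs A b x\<^sub>0 \<alpha> \<eta>s \<mu> \<eta> \<delta>\<^sub>l \<delta>\<^sub>u \<Delta>\<^sub>0 r batch idx g y x res \<delta> \<Delta>"
    and f: "f = avg N fs"
    and f_C1: "cont_diff f"
    and L_pos: "0 < L"
    and grad_Lipschitz: "L-lipschitz_on UNIV (grad f)"
    and f_bounded_below: "\<And>z. fstar \<le> f z"
    and \<eta>s_bound: "\<And>k. 0 \<le> \<eta>s k \<and> \<eta>s k \<le> \<eta>"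
    and \<eta>_less_1: "\<eta> < 1"
    and \<mu>_nonneg: "\<And>k. 0 \<le> \<mu> k"
    and \<mu>_R_linear: "R_linear_to_zero \<mu>"
    and \<kappa>_pos: "0 < \<kappa>"
    and feasible_or_bounded_grad: "AE \<omega> in M.
          (\<forall>k. x k \<omega> \<in> feasible A b) \<or> (\<forall>k. norm (grad f (x k \<omega>)) \<le> \<kappa>)"
    and \<nu>_pos: "0 < \<nu>"
    and variance_bound: "\<And>k. AE \<omega> in M. real_cond_exp M (history M x k)
          (\<lambda>\<omega>. (norm (g k \<omega> - grad f (x k \<omega>)))\<^sup>2) \<omega> \<le> \<nu>"
    and \<alpha>_sum_infinite: "filterlim (\<lambda>n. \<Sum>k<n. \<alpha> k) at_top sequentially"
    and \<alpha>_square_summable: "summable (\<lambda>k. (\<alpha> k)\<^sup>2)"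
  shows "AE \<omega> in M. liminf (\<lambda>k. ereal (norm (search_dir A b f (x k \<omega>)))) = 0
           \<and> convergent (\<lambda>k. f (x k \<omega>))"
proof -
  interpret psg_leco M N fs A b x\<^sub>0 \<alpha> \<eta>s \<mu> \<eta> \<delta>\<^sub>l \<delta>\<^sub>u \<Delta>\<^sub>0 r batch idx g y x res \<delta> \<Delta> by (rule alg)
  show ?thesis
    unfolding f
    by (rule convergence[OF f_C1[unfolded f] L_pos grad_Lipschitz[unfolded f] f_bounded_below[unfolded f]
        \<mu>_R_linear \<kappa>_pos feasible_or_bounded_grad[unfolded f] \<nu>_pos variance_bound[unfolded f]
        \<alpha>_sum_infinite \<alpha>_square_summable])
qed

end
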